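(* Consider the distributed algorithm with least-squares gradient prediction, event-triggered residual transmission and unbiased compressor $\mathcal{Q}$ (with constant $\alpha\ge 1$) described in the context, run with constant step size $\gamma$ from an initial point $\mathbf{x}^{(1)}\in\mathbb{R}^d$ on $f=\sum_{k=1}^K f_k$. Assume: (i) (Lipschitz gradients) for every $k\in[K]$ there is $L_k>0$ with $\|\nabla f_k(\mathbf{x})-\nabla f_k(\mathbf{y})\|\le L_k\|\mathbf{y}-\mathbf{x}\|$ for all $\mathbf{x},\mathbf{y}\in\mathbb{R}^d$; (ii) (strong convexity) for every $k\in[K]$ there is $\mu_k>0$ with $f_k(\mathbf{y})\ge f_k(\mathbf{x})+\nabla f_k(\mathbf{x})^{\mathsf T}(\mathbf{y}-\mathbf{x})+\frac{\mu_k}{2}\|\mathbf{y}-\mathbf{x}\|^2$ for all $\mathbf{x},\mathbf{y}\in\mathbb{R}^d$; (iii) (bounded gradient dissimilarity) there are finite constants $G\ge 0$, $B\ge 1$ such that in every iteration $t$, $\frac1K\sum_{k=1}^K\|\mathbf{g}_k^{(t)}\|^2\le G^2+B^2\|\mathbf{g}^{(t)}\|^2$; (iv) (bounded threshold) in every iteration $t$ there is $b^{(t)}\in[0,1)$ with $\sum_{k=1}^K e_{\mathrm{th},k}^{(t)}=b^{(t)}\|\mathbf{g}^{(t)}\|$. Let $L=\sum_{k=1}^K L_k$, $\mu=\sum_{k=1}^K\mu_k$ and $f^*=\min_{\mathbf{x}}f(\mathbf{x})$. Let $t\ge 1$ be an integer, let $c=\max\{c^{(\tau)}\}_{\tau\in[t-1]}$,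 let $b$ and $\bar\alpha$ be constants with $b\ge\max\{b^{(\tau)}\}_{\tau\in[t-1]}$ and $\bar\alpha\ge\max\{\bar\alpha^{(\tau)}\}_{\tau\in[t-1]}$, and put $P=\max\{\bar\alpha-1,\,c^2\}$. If $$0<\gamma\le\frac{1-b}{L\,\bigl(KB^2P+(1+b)^2\bigr)},$$ then $$\mathbb{E}\{f(\mathbf{x}^{(t)})-f^*\}\le\frac{\gamma LKG^2P}{2\mu(1-b)}+\bigl(1-\mu\gamma(1-b)\bigr)^{t-1}\left(f(\mathbf{x}^{(1)})-f^*-\frac{\gamma LKG^2P}{2\mu(1-b)}\right).$$
   Context: Notation: $[n]=\{1,\dots,n\}$, $\|\cdot\|$ is the Euclidean norm, $A^\dagger$ is the pseudo-inverse. There are $K$ agents with differentiable local losses $f_k:\mathbb{R}^d\to\mathbb{R}$, and $f=\sum_{k=1}^K f_k$. Maxima over $\tau\in[t-1]$ with $t=1$ (empty set) are taken to be $0$. Compressor: $\mathcal{Q}:\mathbb{R}^d\to\mathbb{R}^d$ is a (possibly randomized) unbiased random compressor: $\mathbb{E}\{\mathcal{Q}(\mathbf{x})\}=\mathbf{x}$ and $\mathbb{E}\{\|\mathcal{Q}(\mathbf{x})\|^2\}\le\alpha\|\mathbf{x}\|^2$ for all $\mathbf{x}$, with a constant $\alpha\ge 1$. The agents compress independently of each other, and the randomness of $\mathcal{Q}$ is drawn afresh in each iteration, so these properties hold conditionally on the past. Algorithm: fix a memory length $s\ge 1$. At iteration $t=1,2,\dots$, each agent $k\in[K]$: 1. computes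 $\mathbf{g}_k^{(t)}=\nabla f_k(\mathbf{x}^{(t)})$; write $\mathbf{g}^{(t)}=\sum_{k=1}^K\mathbf{g}_k^{(t)}=\nabla f(\mathbf{x}^{(t)})$; 2. forms $G_k^{(t)}=(\widetilde{\mathbf{g}}_k^{(t-1)}\ \cdots\ \widetilde{\mathbf{g}}_k^{(t-s)})\in\mathbb{R}^{d\times s}$ from its $s$ most recent reconstructed gradients (the initial memory vectors are arbitrary fixed vectors), the least-squares coefficients $\mathbf{a}_k^{*(t)}=(G_k^{(t)})^\dagger\mathbf{g}_k^{(t)}$, a minimizer of $\mathbf{a}\mapsto\|\mathbf{g}_k^{(t)}-G_k^{(t)}\mathbf{a}\|^2$, and the prediction $\hat{\mathbf{g}}_k^{(t)}=G_k^{(t)}\mathbf{a}_k^{*(t)}$; 3. computes the residual $\mathbf{e}_k^{(t)}=\mathbf{g}_k^{(t)}-\hat{\mathbf{g}}_k^{(t)}$ and sets $\widetilde{\mathbf{g}}_k^{(t)}=\hat{\mathbf{g}}_k^{(t)}$ if $\|\mathbf{e}_k^{(t)}\|\le e_{\mathrm{th},k}^{(t)}$, and $\widetilde{\mathbf{g}}_k^{(t)}=\hat{\mathbf{g}}_k^{(t)}+\mathcal{Q}(\mathbf{e}_k^{(t)})$ otherwise. The coefficients are transmitted without distortion, so agent and server hold the same $\widetilde{\mathbf{g}}_k^{(t)}$. The server then updates $\mathbf{x}^{(t+1)}=\mathbf{x}^{(t)}-\gamma\sum_{k=1}^K\widetilde{\mathbf{g}}_k^{(t)}$. Thresholds: $e_{\mathrm{th},k}^{(t)}=c_k^{(t)}\|\mathbf{g}_k^{(t)}\|$,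 where the $c_k^{(t)}\ge 0$ are (deterministic) design parameters, and $c^{(t)}=\max\{c_k^{(t)}\}_{k\in[K]}$. Further quantities: $\alpha_k^{(t)}=1+(\alpha-1)\frac{\|\mathbf{e}_k^{(t)}\|^2}{\|\mathbf{g}_k^{(t)}\|^2}$ (set to $1$ if $\mathbf{g}_k^{(t)}=\mathbf{0}$, in which case $\mathbf{e}_k^{(t)}=\mathbf{0}$), and $\bar\alpha^{(t)}=\max\{\alpha_k^{(t)}\}_{k\in[K]}$. The constants $b$ and $\bar\alpha$ in the claim are deterministic and the inequalities defining them, as well as the assumptions imposed in every iteration, hold for all realizations. $\mathbb{E}$ is the expectation over all compressor randomness; the initial point $\mathbf{x}^{(1)}$ is deterministic. *)

theory Defs
  imports "HOL-Probability.Probability"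
begin

text \<open>The Moore--Penrose inverse, i.e. the unique matrix satisfying the four Penrose equations.\<close>

definition pseudo_inverse :: "real^'n^'m \<Rightarrow> real^'m^'n" where
  "pseudo_inverse A = (THE X. A ** X ** A = A \<and> X ** A ** X = X \<and>
     transpose (A ** X) = A ** X \<and> transpose (X ** A) = X ** A)"

text \<open>A maximum over a finite index set, with the convention that the empty maximum is \<open>0\<close>.\<close>

definition max_or_zero :: "('i \<Rightarrow> real) \<Rightarrow> 'i set \<Rightarrow> real" where
  "max_or_zero h A = (if A = {} then 0 else Max (h ` A))"

text \<open>
  A randomized compressor is a map \<open>Q z v\<close> of a random seed \<open>z\<close> with law \<open>S\<close> and of the vector \<open>v\<close>.
  The integrability requirements express that the two expectations exist (the Bochner integral of a
  non-integrable function is \<open>0\<close>).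
\<close>

definition unbiased_compressor ::
    "'z measure \<Rightarrow> ('z \<Rightarrow> real^'d \<Rightarrow> real^'d) \<Rightarrow> real \<Rightarrow> bool" where
  "unbiased_compressor S Q \<alpha> \<longleftrightarrow>
     prob_space S \<and>
     (\<lambda>(z, v). Q z v) \<in> borel_measurable (S \<Otimes>\<^sub>M borel) \<and>
     (\<forall>v. integrable S (\<lambda>z. Q z v) \<and> (\<integral>z. Q z v \<partial>S) = v) \<and>
     (\<forall>v. integrable S (\<lambda>z. (norm (Q z v))\<^sup>2) \<and>
          (\<integral>z. (norm (Q z v))\<^sup>2 \<partial>S) \<le> \<alpha> * (norm v)\<^sup>2)"

text \<open>
  The memory matrix at iteration \<open>t\<close> for a history \<open>h\<close> indexed by integer times (times \<open>\<le> 0\<close> hold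
  the initial memory).  The columns are indexed by the finite type \<open>'s\<close>; \<open>slot\<close> numbers them
  \<open>1, \<dots>, CARD('s)\<close>, and column number \<open>j\<close> is \<open>h (t - j)\<close>.
\<close>

definition memory_matrix :: "('s::finite \<Rightarrow> nat) \<Rightarrow> (int \<Rightarrow> real^'d) \<Rightarrow> nat \<Rightarrow> real^'s^'d" where
  "memory_matrix slot h t = (\<chi> i j. h (int t - int (slot j)) $ i)"

end

theory Submission
  imports Defs
begin

text \<open>
  Write the aggregated reconstruction as \<open>m + \<Xi>\<close>, where \<open>m\<close> is determined by the past and \<open>\<Xi>\<close> is the
  sum of the compression errors of the transmitting agents.  The threshold condition gives
  \<open>\<parallel>g - m\<parallel> \<le> b \<parallel>g\<parallel>\<close>.  The error of agent \<open>k\<close> has mean \<open>0\<close> conditionally on all other seeds, so the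
  errors are orthogonal to each other and to everything determined by the past, and
  \<open>E \<parallel>m + \<Xi>\<parallel>\<^sup>2 \<le> E (\<parallel>m\<parallel>\<^sup>2 + P \<Sum>\<^sub>k \<parallel>g\<^sub>k\<parallel>\<^sup>2)\<close>.  Inserting this in the descent inequality of an
  \<open>L\<close>-smooth function and using \<open>2 \<mu> (f - f\<^sup>*) \<le> \<parallel>g\<parallel>\<^sup>2\<close> yields an affine recursion for
  \<open>E (f - f\<^sup>*)\<close>.  The least-squares prediction enters only through \<open>\<parallel>e\<^sub>k\<parallel> \<le> \<parallel>g\<^sub>k\<parallel>\<close> and through the
  Borel measurability of the residual.
\<close>

subsection \<open>The Moore--Penrose inverse and least-squares residuals\<close>

definition penrose :: "real^'n^'m \<Rightarrow> real^'m^'n \<Rightarrow> bool" where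
  "penrose A X \<longleftrightarrow> A ** X ** A = A \<and> X ** A ** X = X \<and>
     transpose (A ** X) = A ** X \<and> transpose (X ** A) = X ** A"

text \<open>Both \<open>A ** X\<close> and \<open>A ** Y\<close> are the orthogonal projector onto
  the column space of \<open>A\<close>, and the products in the other order project onto its row
  space. They agree pairwise, which lets \<open>X ** A ** X\<close> be rewritten into
  \<open>Y ** A ** Y\<close>.\<close>

lemma penrose_unique:
  assumes "penrose A X" "penrose A Y"
  shows "X = Y"
proof -
  have X: "A ** X ** A = A" "X ** A ** X = X" "transpose (A ** X) = A ** X" "transpose (X ** A) = X ** A"
    and Y: "A ** Y ** A = A" "Y ** A ** Y = Y" "transpose (A ** Y) = A ** Y" "transpose (Y ** A) = Y ** A"
    using assms by (auto simp: penrose_def)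
  have "A ** X = transpose ((A ** Y) ** (A ** X))"
    using X(3) Y(1) by (simp add: matrix_mul_assoc)
  also have "\<dots> = (A ** X) ** (A ** Y)"
    using X(3) Y(3) by (simp only: matrix_transpose_mul[of "A ** Y" "A ** X"])
  also have "\<dots> = A ** Y"
    using X(1) by (simp add: matrix_mul_assoc)
  finally have AX: "A ** X = A ** Y" .
  have "X ** A = transpose ((X ** A) ** (Y ** A))"
    using X(4) Y(1) by (simp add: matrix_mul_assoc[symmetric])
  also have "\<dots> = (Y ** A) ** (X ** A)"
    using X(4) Y(4) by (simp only: matrix_transpose_mul[of "X ** A" "Y ** A"])
  also have "\<dots> = Y ** A"
    using X(1) by (simp add: matrix_mul_assoc[symmetric])
  finally have XA: "X ** A = Y ** A" .
  have "X = Y ** (A ** X)"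
    using XA X(2) by (simp add: matrix_mul_assoc)
  then show ?thesis
    using AX Y(2) by (simp add: matrix_mul_assoc)
qed

text \<open>A linear right inverse of the map of \<open>A\<close> on its range does it; the full
  inverse is later assembled from such partial ones.\<close>

lemma generalized_inverse_exists:
  fixes A :: "real^'n^'m"
  shows "\<exists>W. A ** W ** A = A"
proof -
  have "linear ((*v) A)" by simp
  then obtain g where g: "linear g" "\<forall>v\<in>range ((*v) A). A *v g v = v"
    using linear_exists_right_inverse_on[of "(*v) A" UNIV] by auto
  have "A ** matrix g ** A = A"
    unfolding matrix_eq using g
    by (auto simp: matrix_vector_mul_assoc[symmetric] fun_cong[OF matrix_vector_mul(2)])
  then show ?thesis ..
qed

lemma gram_eq_0_imp_eq_0:
  fixes B :: "real^'n^'m"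
  assumes "transpose B ** B = 0"
  shows "B = 0"
proof -
  have "B *v x = 0" for x
  proof -
    have "(B *v x) \<bullet> (B *v x) = x \<bullet> ((transpose B ** B) *v x)"
      by (simp add: matrix_vector_mul_assoc[symmetric] inner_commute
          dot_lmul_matrix[symmetric] del: transpose_matrix_vector)
    then show ?thesis using assms by simp
  qed
  then show ?thesis by (simp add: matrix_eq)
qed

lemma matrix_mul_diff_right: "A ** (B - C) = A ** B - A ** (C :: real^'k^'n)"
  and matrix_mul_diff_left: "(B' - C') ** D = B' ** D - C' ** (D :: real^'k^'n)"
  by (simp_all add: matrix_matrix_mult_def vec_eq_iff algebra_simps sum_subtractf)

lemma transpose_diff: "transpose (B - C) = transpose B - transpose (C :: real^'n^'m)"
  by (simp add: transpose_def vec_eq_iff)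

text \<open>The witness comes from the normal equations: \<open>A ** Y ** transpose A\<close> with
  \<open>Y\<close> a generalized inverse of the Gram matrix. \<open>Y\<close> itself need not be
  symmetric.\<close>

lemma column_space_projector_exists:
  fixes A :: "real^'n^'m"
  shows "\<exists>Z. transpose (A ** Z) = A ** Z \<and> A ** Z ** A = A"
proof -
  let ?T = "transpose A"
  have gen: "A ** Y ** ?T ** A = A" if Y: "?T ** A ** Y ** (?T ** A) = ?T ** A" for Y
  proof -
    \<comment> \<open>The defect \<open>?D\<close> is killed by \<open>?T\<close> from the left,
      while its transpose has \<open>?T\<close> as right factor; hence its Gram matrix
      vanishes.\<close>
    let ?D = "A ** Y ** ?T ** A - A"
    have 1: "?T ** ?D = 0"
      using Y by (simp add: matrix_mul_diff_right matrix_mul_assoc)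
    have "transpose ?D = (?T ** A ** transpose Y - mat 1) ** ?T"
      by (simp add: transpose_diff matrix_mul_diff_left matrix_transpose_mul matrix_mul_assoc)
    then have "transpose ?D ** ?D = 0"
      using 1 by (simp add: matrix_mul_assoc[symmetric])
    then show ?thesis
      using gram_eq_0_imp_eq_0[of ?D] by simp
  qed
  obtain Y where Y: "?T ** A ** Y ** (?T ** A) = ?T ** A"
    using generalized_inverse_exists by blast
  \<comment> \<open>The transpose of \<open>Y\<close> is a generalized inverse of the Gram matrix
    too, so \<open>gen\<close> applies to both; comparing the two products yields symmetry.\<close>
  have Y': "?T ** A ** transpose Y ** (?T ** A) = ?T ** A"
    using arg_cong[OF Y, of transpose] by (simp add: matrix_transpose_mul matrix_mul_assoc)
  note 1 = gen[OF Y] and 2 = gen[OF Y']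
  have 3: "?T ** A ** Y ** ?T = ?T"
    using arg_cong[OF 2, of transpose] by (simp add: matrix_transpose_mul matrix_mul_assoc)
  have "A ** transpose Y ** ?T = A ** transpose Y ** ?T ** A ** Y ** ?T"
    using arg_cong[OF 3, of "\<lambda>C. A ** transpose Y ** C"] by (simp add: matrix_mul_assoc)
  also have "\<dots> = A ** Y ** ?T"
    using 2 by simp
  finally have "transpose (A ** (Y ** ?T)) = A ** (Y ** ?T)"
    by (simp add: matrix_transpose_mul matrix_mul_assoc)
  then show ?thesis
    using 1 by (intro exI[of _ "Y ** ?T"]) (simp add: matrix_mul_assoc)
qed

text \<open>An arbitrary generalized inverse \<open>W\<close> becomes the Penrose one after
  projecting onto the row space of \<open>A\<close> on the left and onto its column space on the
  right.\<close>

lemma penrose_exists: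
  fixes A :: "real^'n^'m"
  shows "\<exists>X. penrose A X"
proof -
  obtain Z where Z: "transpose (A ** Z) = A ** Z" "A ** Z ** A = A"
    using column_space_projector_exists by blast
  obtain V where V: "transpose (transpose A ** V) = transpose A ** V"
      "transpose A ** V ** transpose A = transpose A"
    using column_space_projector_exists by blast
  define R where "R = transpose A ** V"
  have R: "transpose R = R" "A ** R = A"
    using V(1) arg_cong[OF V(2), of transpose]
    by (simp_all add: R_def matrix_transpose_mul matrix_mul_assoc[symmetric])
  have RR: "R ** R = R"
    using V(2) by (simp add: R_def matrix_mul_assoc)
  obtain W where W: "A ** W ** A = A"
    using generalized_inverse_exists by blast
  define X where "X = R ** W ** (A ** Z)"
  have AX: "A ** X = A ** Z"
    using R(2) W by (simp add: X_def matrix_mul_assoc)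
  have R': "R = transpose V ** A"
    using R(1) by (simp add: R_def matrix_transpose_mul)
  have "X ** A = R ** W ** A"
    using Z(2) by (simp add: X_def matrix_mul_assoc[symmetric])
  also have "\<dots> = R"
    using W by (simp add: R' matrix_mul_assoc[symmetric])
  finally have XA: "X ** A = R" .
  have "X ** A ** X = X"
    unfolding XA using RR by (simp add: X_def matrix_mul_assoc)
  then show ?thesis
    using AX XA Z R by (auto simp: penrose_def intro!: exI[of _ X])
qed

text \<open>Justifies the definite description behind \<open>pseudo_inverse\<close>; later facts
  about it use the four equations only.\<close>

lemma penrose_pseudo_inverse: "penrose A (pseudo_inverse A)"
proof -
  have "\<exists>!X. penrose A X"
    using penrose_exists penrose_unique by blast
  from theI'[OF this] show ?thesis
    unfolding pseudo_inverse_def penrose_def .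
qed

definition ls_residual :: "real^'n^'m \<Rightarrow> real^'m \<Rightarrow> real^'m" where
  "ls_residual A v = v - A *v (pseudo_inverse A *v v)"

lemma ls_residual_diff: "ls_residual A (v - w) = ls_residual A v - ls_residual A w"
  and ls_residual_add: "ls_residual A (v + w) = ls_residual A v + ls_residual A w"
  by (simp_all add: ls_residual_def matrix_vector_mult_diff_distrib matrix_vector_right_distrib)

text \<open>The third Penrose equation makes \<open>A ** pseudo_inverse A\<close> symmetric, hence
  also its complement.\<close>

lemma ls_residual_symmetric: "ls_residual A v \<bullet> w = v \<bullet> ls_residual A w"
proof -
  let ?P = "A ** pseudo_inverse A"
  have "transpose ?P = ?P"
    using penrose_pseudo_inverse[of A] by (simp add: penrose_def)
  then have "(?P *v v) \<bullet> w = v \<bullet> (?P *v w)"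
    using vector_transpose_matrix[of v ?P] dot_lmul_matrix[of v ?P w] by simp
  then show ?thesis
    by (simp add: ls_residual_def inner_diff_left inner_diff_right matrix_vector_mul_assoc)
qed

lemma ls_residual_matrix_vector: "ls_residual A (A *v a) = 0"
  using penrose_pseudo_inverse[of A]
  by (simp add: ls_residual_def penrose_def matrix_vector_mul_assoc matrix_mul_assoc)

lemma ls_residual_idem: "ls_residual A (ls_residual A v) = ls_residual A v"
  by (subst (2) ls_residual_def) (simp add: ls_residual_diff ls_residual_matrix_vector)

text \<open>For a symmetric idempotent map the squared norm of the image is its inner product with
  \<open>v\<close>; Cauchy-Schwarz then cancels one factor.\<close>

lemma norm_ls_residual_le: "norm (ls_residual A v) \<le> norm v"
proof -
  have "(norm (ls_residual A v))\<^sup>2 = v \<bullet> ls_residual A v"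
    by (simp add: power2_norm_eq_inner ls_residual_symmetric ls_residual_idem)
  also have "\<dots> \<le> norm v * norm (ls_residual A v)"
    by (rule norm_cauchy_schwarz)
  finally show ?thesis
    by (cases "ls_residual A v = 0") (auto simp: power2_eq_square)
qed

text \<open>Optimality of least squares: subtracting a combination of columns leaves the residual
  unchanged, and taking residuals does not lengthen vectors. The strict form writes a sublevel set
  as a union of open sets over \<open>a\<close>.\<close>

lemma norm_ls_residual_less_iff:
  "norm (ls_residual A v) < r \<longleftrightarrow> (\<exists>a. norm (v - A *v a) < r)"
proof
  show "norm (ls_residual A v) < r \<Longrightarrow> \<exists>a. norm (v - A *v a) < r"
    unfolding ls_residual_def by blast
next
  assume "\<exists>a. norm (v - A *v a) < r"
  then obtain a where a: "norm (v - A *v a) < r" ..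
  have "ls_residual A (v - A *v a) = ls_residual A v"
    by (simp add: ls_residual_diff ls_residual_matrix_vector)
  then show "norm (ls_residual A v) < r"
    using norm_ls_residual_le[of A "v - A *v a"] a by simp
qed

lemma continuous_on_matrix_vector_mult_left:
  "continuous_on S (\<lambda>A::real^'n^'m. A *v a)"
  unfolding matrix_vector_mult_def by (intro continuous_intros)

text \<open>The residual norm is an infimum of continuous functions of \<open>(A, v)\<close>, so its strict
  sublevel sets are open, although \<open>pseudo_inverse\<close> is discontinuous.\<close>

lemma borel_measurable_norm_ls_residual:
  "(\<lambda>p. norm (ls_residual (fst p) (snd p)))
     \<in> borel_measurable (borel :: ((real^'n^'m) \<times> (real^'m)) measure)"
proof (rule borel_measurableI_less)
  fix r :: real
  have "{p :: (real^'n^'m) \<times> (real^'m). norm (ls_residual (fst p) (snd p)) < r}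
      = (\<Union>a. {p. norm (snd p - fst p *v a) < r})"
    by (auto simp: norm_ls_residual_less_iff)
  moreover have "open {p :: (real^'n^'m) \<times> (real^'m). norm (snd p - fst p *v a) < r}" for a
    by (intro open_Collect_less continuous_intros
        continuous_on_compose2[OF continuous_on_matrix_vector_mult_left]) auto
  ultimately show "{p \<in> space borel. norm (ls_residual (fst p) (snd p)) < r}
      \<in> sets (borel :: ((real^'n^'m) \<times> (real^'m)) measure)"
    by (auto intro!: borel_open open_UN)
qed

text \<open>So far only the norm of the residual is known to be measurable. As the residual map is a
  symmetric idempotent, polarization recovers each coordinate from two such norms.\<close>

lemma borel_measurable_ls_residual:
  fixes A :: "'a \<Rightarrow> real^'n^'m" and v :: "'a \<Rightarrow> real^'m"
  assumes A: "A \<in> borel_measurable M" and v: "v \<in> borel_measurable M"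
  shows "(\<lambda>\<omega>. ls_residual (A \<omega>) (v \<omega>)) \<in> borel_measurable M"
proof -
  have norm: "(\<lambda>\<omega>. norm (ls_residual (A \<omega>) (u \<omega>))) \<in> borel_measurable M"
    if u: "u \<in> borel_measurable M" for u
    using measurable_compose[OF borel_measurable_Pair[OF A u] borel_measurable_norm_ls_residual]
    by simp
  have polar: "ls_residual B u \<bullet> w
      = ((norm (ls_residual B (u + w)))\<^sup>2 - (norm (ls_residual B (u - w)))\<^sup>2) / 4"
    for B :: "real^'n^'m" and u w
    using ls_residual_symmetric[of B "ls_residual B u" w]
    by (simp add: power2_norm_eq_inner ls_residual_add ls_residual_diff ls_residual_idem
        inner_add_left inner_diff_left inner_add_right inner_diff_right inner_commute)
  show ?thesis
    by (subst borel_measurable_euclidean_space, unfold polar)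
      (intro ballI borel_measurable_divide borel_measurable_diff borel_measurable_power norm
        borel_measurable_add v borel_measurable_const)
qed

lemma borel_measurable_matrixI:
  fixes A :: "'a \<Rightarrow> real^'n^'m"
  assumes "\<And>i j. (\<lambda>\<omega>. A \<omega> $ i $ j) \<in> borel_measurable M"
  shows "A \<in> borel_measurable M"
  using assms by (subst borel_measurable_euclidean_space) (auto simp: Basis_vec_def inner_axis)

subsection \<open>Smooth and strongly convex functions\<close>

text \<open>Along the segment from \<open>y\<close> to \<open>z\<close>, the difference of
  \<open>f\<close> and its quadratic model has nonpositive derivative.\<close>

lemma lipschitz_gradient_upper_bound:
  fixes f :: "'a::real_inner \<Rightarrow> real"
  assumes grad: "\<And>y. GDERIV f y :> grad y"
    and lip: "\<And>y z. norm (grad y - grad z) \<le> L * norm (z - y)"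
  shows "f z \<le> f y + grad y \<bullet> (z - y) + L / 2 * (norm (z - y))\<^sup>2"
proof -
  define d where "d = z - y"
  define \<phi> where "\<phi> s = f (y + s *\<^sub>R d) - s * (grad y \<bullet> d) - L / 2 * s\<^sup>2 * (norm d)\<^sup>2" for s :: real
  define \<phi>' where "\<phi>' s = (d \<bullet> grad (y + s *\<^sub>R d)) - grad y \<bullet> d - L * s * (norm d)\<^sup>2" for s :: real
  have "(\<phi> has_real_derivative \<phi>' s) (at s)" for s
  proof -
    have "((\<lambda>s. y + s *\<^sub>R d) has_derivative (\<lambda>h. h *\<^sub>R d)) (at s)"
      by (auto intro!: derivative_eq_intros)
    moreover have "(f has_derivative (\<lambda>h. h \<bullet> grad (y + s *\<^sub>R d))) (at (y + s *\<^sub>R d))"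
      using grad by (simp add: gderiv_def)
    ultimately have "((\<lambda>s. f (y + s *\<^sub>R d)) has_derivative
        (\<lambda>h. (h *\<^sub>R d) \<bullet> grad (y + s *\<^sub>R d))) (at s)"
      by (rule has_derivative_compose)
    then have "((\<lambda>s. f (y + s *\<^sub>R d)) has_real_derivative (d \<bullet> grad (y + s *\<^sub>R d))) (at s)"
      by (simp add: has_field_derivative_def mult.commute[of _ "d \<bullet> _"] mult_commute_abs)
    then show ?thesis
      unfolding \<phi>_def \<phi>'_def by (auto intro!: derivative_eq_intros)
  qed
  moreover have "\<phi>' s \<le> 0" if "0 \<le> s" for s
  proof -
    have "(grad (y + s *\<^sub>R d) - grad y) \<bullet> d \<le> norm (grad (y + s *\<^sub>R d) - grad y) * norm d"
      by (rule norm_cauchy_schwarz)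
    also have "\<dots> \<le> (L * norm (y - (y + s *\<^sub>R d))) * norm d"
      by (intro mult_right_mono lip) auto
    also have "\<dots> = L * s * (norm d)\<^sup>2"
      using that by (simp add: power2_eq_square)
    finally show ?thesis
      by (simp add: \<phi>'_def inner_diff_left inner_diff_right inner_commute)
  qed
  ultimately have "\<phi> 1 \<le> \<phi> 0"
    by (intro DERIV_nonpos_imp_nonincreasing[of 0 1 \<phi>]) auto
  then show ?thesis
    by (simp add: \<phi>_def d_def)
qed

text \<open>Strong convexity between \<open>0\<close> and a unit vector, used in both directions,
  bounds the gradient increment from below by \<mu>; the Lipschitz condition bounds it by
  \<open>L\<close>. This later keeps the contraction factor nonnegative.\<close>

lemma strongly_convex_le_lipschitz:
  fixes grad :: "'a::euclidean_space \<Rightarrow> 'a"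
  assumes sc: "\<And>y z. f z \<ge> f y + grad y \<bullet> (z - y) + \<mu> / 2 * (norm (z - y))\<^sup>2"
    and lip: "\<And>y z. norm (grad y - grad z) \<le> L * norm (z - y)"
  shows "\<mu> \<le> L"
proof -
  obtain u :: 'a where u: "norm u = 1"
    using norm_Basis nonempty_Basis by blast
  have "\<mu> \<le> (grad u - grad 0) \<bullet> u"
    using sc[of 0 u] sc[of u 0] u by (simp add: inner_diff_left)
  also have "\<dots> \<le> norm (grad u - grad 0) * norm u"
    by (rule norm_cauchy_schwarz)
  also have "\<dots> \<le> L"
    using lip[of u 0] u by simp
  finally show ?thesis .
qed

text \<open>The quadratic lower bound makes \<open>F\<close> coercive, so a minimizer on a large
  ball is global. This is what gives \<open>ARG_MIN\<close> its meaning later.\<close>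

lemma strongly_convex_has_minimizer:
  fixes F :: "'a::euclidean_space \<Rightarrow> real"
  assumes cont: "continuous_on UNIV F" and \<mu>: "0 < \<mu>"
    and sc: "\<And>z. F z \<ge> F 0 + g0 \<bullet> z + \<mu> / 2 * (norm z)\<^sup>2"
  shows "\<exists>y. \<forall>z. F y \<le> F z"
proof -
  \<comment> \<open>Beyond this radius the quadratic term outweighs the linear one.\<close>
  define R where "R = 2 * norm g0 / \<mu>"
  have R: "0 \<le> R" using \<mu> by (simp add: R_def)
  have far: "F 0 \<le> F z" if "R < norm z" for z
  proof -
    have "norm g0 * norm z \<le> \<mu> / 2 * norm z * norm z"
      using that \<mu> by (intro mult_right_mono) (auto simp: R_def field_simps)
    moreover have "- (norm g0 * norm z) \<le> g0 \<bullet> z"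
      using norm_cauchy_schwarz[of "- g0" z] by simp
    ultimately show ?thesis
      using sc[of z] by (simp add: power2_eq_square)
  qed
  have "compact (cball (0::'a) R)" "cball (0::'a) R \<noteq> {}"
    using R by auto
  then obtain y where y: "\<forall>z\<in>cball 0 R. F y \<le> F z"
    using continuous_attains_inf[of "cball 0 R" F] cont continuous_on_subset by blast
  have "F y \<le> F z" for z
  proof (cases "norm z \<le> R")
    case True
    then show ?thesis using y by simp
  next
    case False
    have "F y \<le> F 0" using y R by simp
    then show ?thesis using far[of z] False by simp
  qed
  then show ?thesis by blast
qed

text \<open>Completing the square in \<open>g + \<mu> *\<^sub>R d\<close>. It is applied with
  \<open>Fz\<close> the minimum value.\<close>

lemma polyak_lojasiewicz:
  fixes g :: "'a::real_inner"
  assumes \<mu>: "0 < \<mu>"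
    and sc: "Fz \<ge> Fy + g \<bullet> d + \<mu> / 2 * (norm d)\<^sup>2"
  shows "2 * \<mu> * (Fy - Fz) \<le> (norm g)\<^sup>2"
proof -
  have "0 \<le> (norm (g + \<mu> *\<^sub>R d))\<^sup>2" by simp
  also have "\<dots> = (norm g)\<^sup>2 + 2 * \<mu> * (g \<bullet> d + \<mu> / 2 * (norm d)\<^sup>2)"
    unfolding power2_norm_eq_inner
    by (simp add: inner_add_left inner_add_right inner_commute[of d g] field_simps)
  also have "\<dots> \<le> (norm g)\<^sup>2 + 2 * \<mu> * (Fz - Fy)"
    using sc \<mu> by (intro add_left_mono mult_left_mono) auto
  finally show ?thesis by (simp add: algebra_simps)
qed

text \<open>\<open>C\<close> is the fixed point of the affine map, so the offset from
  \<open>C\<close> shrinks by \<rho> at each step. The step is required only below \<open>t\<close>,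
  since the constants of the theorem control just those iterations.\<close>

lemma affine_recursion_bound:
  fixes E :: "nat \<Rightarrow> real"
  assumes step: "\<And>n. 1 \<le> n \<Longrightarrow> n < t \<Longrightarrow> E (Suc n) \<le> \<rho> * E n + (1 - \<rho>) * C"
    and \<rho>: "0 \<le> \<rho>" and n: "1 \<le> n" "n \<le> t"
  shows "E n \<le> C + \<rho> ^ (n - 1) * (E 1 - C)"
  using n
proof (induction n rule: dec_induct)
  case base
  then show ?case by simp
next
  case (step m)
  have "E (Suc m) \<le> \<rho> * E m + (1 - \<rho>) * C"
    using step.hyps step.prems by (intro assms(1)) auto
  also have "\<dots> \<le> \<rho> * (C + \<rho> ^ (m - 1) * (E 1 - C)) + (1 - \<rho>) * C"
    using step \<rho> by (intro add_right_mono mult_left_mono) auto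
  also have "\<dots> = C + \<rho> ^ Suc (m - 1) * (E 1 - C)"
    by (simp add: algebra_simps)
  finally show ?case using step.hyps by simp
qed

subsection \<open>Square-integrable random vectors\<close>

definition square_integrable :: "'w measure \<Rightarrow> ('w \<Rightarrow> 'b::euclidean_space) \<Rightarrow> bool" where
  "square_integrable M u \<longleftrightarrow> u \<in> borel_measurable M \<and> integrable M (\<lambda>\<omega>. (norm (u \<omega>))\<^sup>2)"

lemma square_integrable_bound:
  assumes "square_integrable M v" "u \<in> borel_measurable M"
    and "\<And>\<omega>. \<omega> \<in> space M \<Longrightarrow> norm (u \<omega>) \<le> C * norm (v \<omega>)"
  shows "square_integrable M u"
proof -
  have "integrable M (\<lambda>\<omega>. C\<^sup>2 * (norm (v \<omega>))\<^sup>2)"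
    using assms by (auto simp: square_integrable_def)
  then have "integrable M (\<lambda>\<omega>. (norm (u \<omega>))\<^sup>2)"
  proof (rule Bochner_Integration.integrable_bound)
    show "(\<lambda>\<omega>. (norm (u \<omega>))\<^sup>2) \<in> borel_measurable M"
      using assms(2) by simp
    show "AE \<omega> in M. norm ((norm (u \<omega>))\<^sup>2) \<le> norm (C\<^sup>2 * (norm (v \<omega>))\<^sup>2)"
      using power_mono[OF assms(3), of _ 2] by (auto simp: power_mult_distrib)
  qed
  then show ?thesis using assms(2) by (simp add: square_integrable_def)
qed

lemma integrable_inner_of_square_integrable:
  fixes u v :: "'w \<Rightarrow> 'b::euclidean_space"
  assumes "square_integrable M u" "square_integrable M v"
  shows "integrable M (\<lambda>\<omega>. u \<omega> \<bullet> v \<omega>)"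
proof (rule Bochner_Integration.integrable_bound)
  show "integrable M (\<lambda>\<omega>. (norm (u \<omega>))\<^sup>2 + (norm (v \<omega>))\<^sup>2)"
    using assms by (auto simp: square_integrable_def)
  show "(\<lambda>\<omega>. u \<omega> \<bullet> v \<omega>) \<in> borel_measurable M"
    using assms by (auto simp: square_integrable_def)
  have "\<bar>a \<bullet> b\<bar> \<le> (norm a)\<^sup>2 + (norm b)\<^sup>2" for a b :: 'b
  proof -
    have "\<bar>a \<bullet> b\<bar> \<le> norm a * norm b"
      by (rule Cauchy_Schwarz_ineq2)
    also have "\<dots> \<le> (norm a)\<^sup>2 + (norm b)\<^sup>2"
      using sum_squares_bound[of "norm a" "norm b"]
        mult_nonneg_nonneg[OF norm_ge_zero[of a] norm_ge_zero[of b]] by linarith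
    finally show ?thesis .
  qed
  then show "AE \<omega> in M. norm (u \<omega> \<bullet> v \<omega>) \<le> norm ((norm (u \<omega>))\<^sup>2 + (norm (v \<omega>))\<^sup>2)"
    by auto
qed

lemma square_integrable_add:
  fixes u v :: "'w \<Rightarrow> 'b::euclidean_space"
  assumes "square_integrable M u" "square_integrable M v"
  shows "square_integrable M (\<lambda>\<omega>. u \<omega> + v \<omega>)"
proof -
  have "(norm (a + b))\<^sup>2 = (norm a)\<^sup>2 + 2 * (a \<bullet> b) + (norm b)\<^sup>2" for a b :: 'b
    by (simp add: power2_norm_eq_inner inner_add_left inner_add_right inner_commute)
  then show ?thesis
    using assms integrable_inner_of_square_integrable[OF assms]
    by (auto simp: square_integrable_def intro!: borel_measurable_add)
qed

lemma square_integrable_scaleR: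
  "square_integrable M u \<Longrightarrow> square_integrable M (\<lambda>\<omega>. c *\<^sub>R u \<omega>)"
  by (rule square_integrable_bound[where C = "\<bar>c\<bar>"])
    (auto simp: square_integrable_def intro!: borel_measurable_scaleR)

lemma square_integrable_diff:
  assumes "square_integrable M u" "square_integrable M v"
  shows "square_integrable M (\<lambda>\<omega>. u \<omega> - v \<omega>)"
  using square_integrable_add[OF assms(1) square_integrable_scaleR[OF assms(2), of "- 1"]]
  by simp

lemma square_integrable_sum:
  "(\<And>k. k \<in> A \<Longrightarrow> square_integrable M (u k)) \<Longrightarrow> square_integrable M (\<lambda>\<omega>. \<Sum>k\<in>A. u k \<omega>)"
  by (induction A rule: infinite_finite_induct)
    (auto simp: square_integrable_add, simp_all add: square_integrable_def)

lemma (in finite_measure) square_integrable_const: "square_integrable M (\<lambda>_. c)"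
  by (simp add: square_integrable_def)

lemma square_integrable_cong:
  assumes "\<And>\<omega>. \<omega> \<in> space M \<Longrightarrow> u \<omega> = v \<omega>"
  shows "square_integrable M u \<longleftrightarrow> square_integrable M v"
  unfolding square_integrable_def using assms
  by (intro conj_cong measurable_cong Bochner_Integration.integrable_cong) auto

text \<open>Pythagoras in L2: each new summand is orthogonal to \<open>m\<close> and to all summands
  added before it.\<close>

lemma integral_norm_square_orthogonal_sum:
  assumes "finite A" and m: "square_integrable M m"
    and \<xi>: "\<And>k. k \<in> A \<Longrightarrow> square_integrable M (\<xi> k)"
    and m\<xi>: "\<And>k. k \<in> A \<Longrightarrow> (\<integral>\<omega>. m \<omega> \<bullet> \<xi> k \<omega> \<partial>M) = 0"
    and \<xi>\<xi>: "\<And>k l. k \<in> A \<Longrightarrow> l \<in> A \<Longrightarrow> k \<noteq> l \<Longrightarrow> (\<integral>\<omega>. \<xi> k \<omega> \<bullet> \<xi> l \<omega> \<partial>M) = 0"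
  shows "(\<integral>\<omega>. (norm (m \<omega> + (\<Sum>k\<in>A. \<xi> k \<omega>)))\<^sup>2 \<partial>M)
    = (\<integral>\<omega>. (norm (m \<omega>))\<^sup>2 \<partial>M) + (\<Sum>k\<in>A. \<integral>\<omega>. (norm (\<xi> k \<omega>))\<^sup>2 \<partial>M)"
  using assms
proof (induction A rule: finite_induct)
  case empty
  then show ?case by simp
next
  case (insert k A)
  let ?u = "\<lambda>\<omega>. m \<omega> + (\<Sum>l\<in>A. \<xi> l \<omega>)"
  note sq = insert.prems(2)
  have u: "square_integrable M ?u"
    by (intro square_integrable_add square_integrable_sum) (use insert.prems in auto)
  have "(\<integral>\<omega>. ?u \<omega> \<bullet> \<xi> k \<omega> \<partial>M)
      = (\<integral>\<omega>. m \<omega> \<bullet> \<xi> k \<omega> \<partial>M) + (\<Sum>l\<in>A. \<integral>\<omega>. \<xi> l \<omega> \<bullet> \<xi> k \<omega> \<partial>M)"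
    using insert.prems(1) sq
    by (simp add: inner_add_left inner_sum_left integrable_inner_of_square_integrable)
  also have "\<dots> = 0"
    using insert.prems(3,4) insert.hyps(2) by (auto intro!: sum.neutral)
  finally have orth: "(\<integral>\<omega>. ?u \<omega> \<bullet> \<xi> k \<omega> \<partial>M) = 0" .
  have "(norm (m \<omega> + (\<Sum>l\<in>insert k A. \<xi> l \<omega>)))\<^sup>2
      = (norm (?u \<omega>))\<^sup>2 + 2 * (?u \<omega> \<bullet> \<xi> k \<omega>) + (norm (\<xi> k \<omega>))\<^sup>2" for \<omega>
  proof -
    have "m \<omega> + (\<Sum>l\<in>insert k A. \<xi> l \<omega>) = ?u \<omega> + \<xi> k \<omega>"
      using insert.hyps by (simp add: algebra_simps)
    then show ?thesis
      using dot_norm[of "?u \<omega>" "\<xi> k \<omega>"] by (simp add: add.assoc)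
  qed
  then have "(\<integral>\<omega>. (norm (m \<omega> + (\<Sum>l\<in>insert k A. \<xi> l \<omega>)))\<^sup>2 \<partial>M)
      = (\<integral>\<omega>. (norm (?u \<omega>))\<^sup>2 + 2 * (?u \<omega> \<bullet> \<xi> k \<omega>) + (norm (\<xi> k \<omega>))\<^sup>2 \<partial>M)"
    by simp
  also have "\<dots> = (\<integral>\<omega>. (norm (?u \<omega>))\<^sup>2 \<partial>M) + 2 * (\<integral>\<omega>. ?u \<omega> \<bullet> \<xi> k \<omega> \<partial>M)
      + (\<integral>\<omega>. (norm (\<xi> k \<omega>))\<^sup>2 \<partial>M)"
    using u sq[of k] integrable_inner_of_square_integrable[OF u sq[of k]]
    by (subst Bochner_Integration.integral_add | simp add: square_integrable_def)+
  also have "\<dots> = (\<integral>\<omega>. (norm (?u \<omega>))\<^sup>2 \<partial>M) + (\<integral>\<omega>. (norm (\<xi> k \<omega>))\<^sup>2 \<partial>M)"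
    using orth by simp
  also have "(\<integral>\<omega>. (norm (?u \<omega>))\<^sup>2 \<partial>M)
      = (\<integral>\<omega>. (norm (m \<omega>))\<^sup>2 \<partial>M) + (\<Sum>k\<in>A. \<integral>\<omega>. (norm (\<xi> k \<omega>))\<^sup>2 \<partial>M)"
    using insert.prems by (intro insert.IH) auto
  finally show ?case
    using insert.hyps by simp
qed

subsection \<open>Noise driven by a fresh seed\<close>

text \<open>Independence is stated through events because \<open>indep_var\<close> requires both random variables to
  have the same value type.\<close>

lemma (in prob_space) other_variables_algebra:
  assumes ind: "indep_vars (\<lambda>_. S) X I" and j: "j \<in> I"
  obtains N where "space N = space M" "sets N \<subseteq> sets M"
    "\<And>i. i \<in> I \<Longrightarrow> i \<noteq> j \<Longrightarrow> X i \<in> N \<rightarrow>\<^sub>M S"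
    "\<And>A B. A \<in> sets N \<Longrightarrow> B \<in> sets S \<Longrightarrow>
      prob (A \<inter> (X j -` B \<inter> space M)) = prob A * prob (X j -` B \<inter> space M)"
proof -
  define J where "J = I - {j}"
  \<comment> \<open>\<open>Y\<close> bundles all seeds except number \<open>j\<close> and
    \<open>W\<close> holds that one alone, so both are product-valued and independent as disjoint
    blocks; \<open>N\<close> is generated by \<open>Y\<close>.\<close>
  define Y where "Y = (\<lambda>\<omega>. restrict (\<lambda>i. X i \<omega>) J)"
  define W where "W = (\<lambda>\<omega>. restrict (\<lambda>i. X i \<omega>) {j})"
  define N where "N = vimage_algebra (space M) Y (PiM J (\<lambda>_. S))"
  have YW: "indep_var (PiM J (\<lambda>_. S)) Y (PiM {j} (\<lambda>_. S)) W"
    unfolding Y_def W_def using j by (intro indep_var_restrict[OF ind]) (auto simp: J_def)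
  then have Y: "Y \<in> M \<rightarrow>\<^sub>M PiM J (\<lambda>_. S)"
    by (rule indep_var_rv1)
  have Y_Pi: "Y \<in> space M \<rightarrow> space (PiM J (\<lambda>_. S))"
    using measurable_space[OF Y] by auto
  have YN: "Y \<in> N \<rightarrow>\<^sub>M PiM J (\<lambda>_. S)"
    unfolding N_def by (rule measurable_vimage_algebra1[OF Y_Pi])
  have sets_N: "sets N = {Y -` A \<inter> space M |A. A \<in> sets (PiM J (\<lambda>_. S))}"
    unfolding N_def by (rule sets_vimage_algebra2[OF Y_Pi])
  show ?thesis
  proof (rule that)
    show "space N = space M"
      by (simp add: N_def)
    show "sets N \<subseteq> sets M"
      unfolding sets_N using measurable_sets[OF Y] by auto
    show "X i \<in> N \<rightarrow>\<^sub>M S" if "i \<in> I" "i \<noteq> j" for i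
    proof -
      have "i \<in> J" using that by (simp add: J_def)
      from measurable_compose[OF YN measurable_component_singleton[OF this]] \<open>i \<in> J\<close>
      show ?thesis by (simp add: Y_def)
    qed
    fix A B assume A: "A \<in> sets N" and B: "B \<in> sets S"
    obtain A' where A': "A' \<in> sets (PiM J (\<lambda>_. S))" "A = Y -` A' \<inter> space M"
      using A by (auto simp: sets_N)
    let ?B = "(\<lambda>f. f j) -` B \<inter> space (PiM {j} (\<lambda>_. S))"
    have B': "?B \<in> sets (PiM {j} (\<lambda>_. S))"
      using B by (intro measurable_sets[OF measurable_component_singleton]) auto
    have "W -` ?B \<inter> space M = X j -` B \<inter> space M"
      using measurable_space[OF indep_var_rv2[OF YW]] by (auto simp: W_def)
    moreover have "(\<lambda>\<omega>. (Y \<omega>, W \<omega>)) -` (A' \<times> ?B) \<inter> space M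
        = (Y -` A' \<inter> space M) \<inter> (W -` ?B \<inter> space M)"
      by blast
    ultimately show "prob (A \<inter> (X j -` B \<inter> space M)) = prob A * prob (X j -` B \<inter> space M)"
      using indep_varD[OF YW A'(1) B'] A'(2) by simp
  qed
qed

text \<open>A substitute for conditional expectation: \<open>N\<close> carries everything except the
  seed \<open>Z\<close>, \<open>H \<omega>\<close> is the noise as a function of the seed once the
  rest is frozen, and \<open>\<psi>\<close> bounds its conditional second moment.\<close>

locale fresh_kernel = prob_space M for M :: "'w measure" +
  fixes N :: "'w measure" and S :: "'z measure" and Z :: "'w \<Rightarrow> 'z"
    and H :: "'w \<Rightarrow> 'z \<Rightarrow> 'b::euclidean_space" and \<psi> :: "'w \<Rightarrow> real"
  assumes space_N: "space N = space M"
    and sets_N: "sets N \<subseteq> sets M"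
    and measurable_Z: "Z \<in> M \<rightarrow>\<^sub>M S"
    and indep: "\<And>A B. A \<in> sets N \<Longrightarrow> B \<in> sets S \<Longrightarrow>
      prob (A \<inter> (Z -` B \<inter> space M)) = prob A * prob (Z -` B \<inter> space M)"
    and law: "distr M S Z = S"
    and measurable_H: "(\<lambda>(\<omega>, z). H \<omega> z) \<in> borel_measurable (N \<Otimes>\<^sub>M S)"
    and centered: "\<And>\<omega>. \<omega> \<in> space M \<Longrightarrow> integrable S (H \<omega>) \<and> (\<integral>z. H \<omega> z \<partial>S) = 0"
    and variance: "\<And>\<omega>. \<omega> \<in> space M \<Longrightarrow>
      integrable S (\<lambda>z. (norm (H \<omega> z))\<^sup>2) \<and> (\<integral>z. (norm (H \<omega> z))\<^sup>2 \<partial>S) \<le> \<psi> \<omega>"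
    and measurable_\<psi>: "\<psi> \<in> borel_measurable N"
    and integrable_\<psi>: "integrable M \<psi>"
begin

lemma measurable_id_N: "(\<lambda>\<omega>. \<omega>) \<in> M \<rightarrow>\<^sub>M N"
  using sets_N sets.sets_into_space[of _ N]
  by (auto simp: measurable_def space_N Int_absorb2)

lemma measurable_pair: "(\<lambda>\<omega>. (\<omega>, Z \<omega>)) \<in> M \<rightarrow>\<^sub>M N \<Otimes>\<^sub>M S"
  using measurable_Z measurable_id_N by measurable

text \<open>The restriction of \<open>M\<close> to the events of \<open>N\<close>, as an image
  measure under the identity, so that it can be a factor of a product.\<close>

definition D where "D = distr M N (\<lambda>\<omega>. \<omega>)"

lemma sets_D [measurable_cong]: "sets D = sets N" and space_D: "space D = space M"
  by (simp_all add: D_def space_N)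

lemma prob_spaces: "prob_space D" "prob_space S"
  using prob_space_distr[OF measurable_Z] prob_space_distr[OF measurable_id_N]
  by (simp_all add: law D_def)

text \<open>Independence says that the two measures agree on rectangles, which determine a product
  measure. Fubini can then integrate the seed out with \<omega> held fixed.\<close>

lemma joint: "distr M (N \<Otimes>\<^sub>M S) (\<lambda>\<omega>. (\<omega>, Z \<omega>)) = D \<Otimes>\<^sub>M S"
proof (rule pair_measure_eqI[symmetric])
  interpret D: prob_space D by (rule prob_spaces)
  interpret S: prob_space S by (rule prob_spaces)
  show "sigma_finite_measure D" "sigma_finite_measure S" ..
  show "sets (D \<Otimes>\<^sub>M S) = sets (distr M (N \<Otimes>\<^sub>M S) (\<lambda>\<omega>. (\<omega>, Z \<omega>)))"
    by (simp add: sets_D cong: sets_pair_measure_cong)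
  fix A B assume "A \<in> sets D" and B: "B \<in> sets S"
  then have A: "A \<in> sets N" by (simp add: sets_D)
  have "emeasure D A = prob A"
    using A sets.sets_into_space[OF A]
    by (simp add: D_def emeasure_distr[OF measurable_id_N] space_N Int_absorb2 emeasure_eq_measure)
  moreover have "emeasure S B = prob (Z -` B \<inter> space M)"
    using B by (subst law[symmetric]) (simp add: emeasure_distr[OF measurable_Z] emeasure_eq_measure)
  moreover have "(\<lambda>\<omega>. (\<omega>, Z \<omega>)) -` (A \<times> B) \<inter> space M = A \<inter> (Z -` B \<inter> space M)"
    by auto
  ultimately show "emeasure D A * emeasure S B
      = emeasure (distr M (N \<Otimes>\<^sub>M S) (\<lambda>\<omega>. (\<omega>, Z \<omega>))) (A \<times> B)"
    using A B indep[OF A B]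
    by (simp add: emeasure_distr[OF measurable_pair] emeasure_eq_measure ennreal_mult)
qed

lemma measurable_noise: "(\<lambda>\<omega>. H \<omega> (Z \<omega>)) \<in> borel_measurable M"
  using measurable_compose[OF measurable_pair measurable_H] by simp

text \<open>Tonelli on the product, then \<open>variance\<close> in the inner integral. Nonnegative
  integrals appear because integrability of the squared noise is deduced from this bound.\<close>

lemma nn_integral_noise:
  "(\<integral>\<^sup>+\<omega>. ennreal ((norm (H \<omega> (Z \<omega>)))\<^sup>2) \<partial>M) \<le> (\<integral>\<^sup>+\<omega>. ennreal (\<psi> \<omega>) \<partial>M)"
proof -
  interpret S: prob_space S by (rule prob_spaces)
  note measurable_H [measurable]
  have "(\<integral>\<^sup>+\<omega>. ennreal ((norm (H \<omega> (Z \<omega>)))\<^sup>2) \<partial>M)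
      = (\<integral>\<^sup>+p. ennreal ((norm (case p of (\<omega>, z) \<Rightarrow> H \<omega> z))\<^sup>2) \<partial>(D \<Otimes>\<^sub>M S))"
    unfolding joint[symmetric] by (subst nn_integral_distr[OF measurable_pair]) simp_all
  also have "\<dots> = (\<integral>\<^sup>+\<omega>. \<integral>\<^sup>+z. ennreal ((norm (H \<omega> z))\<^sup>2) \<partial>S \<partial>D)"
    by (subst S.nn_integral_fst[symmetric]) simp_all
  also have "\<dots> \<le> (\<integral>\<^sup>+\<omega>. ennreal (\<psi> \<omega>) \<partial>D)"
    using variance
    by (intro nn_integral_mono) (auto simp: space_D nn_integral_eq_integral intro!: ennreal_leI)
  also have "\<dots> = (\<integral>\<^sup>+\<omega>. ennreal (\<psi> \<omega>) \<partial>M)"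
    unfolding D_def by (rule nn_integral_distr[OF measurable_id_N]) (use measurable_\<psi> in simp)
  finally show ?thesis .
qed

lemma \<psi>_nonneg: "\<omega> \<in> space M \<Longrightarrow> 0 \<le> \<psi> \<omega>"
  using variance[of \<omega>] by (auto intro: order_trans[rotated])

lemma nn_integral_\<psi>: "(\<integral>\<^sup>+\<omega>. ennreal (\<psi> \<omega>) \<partial>M) = ennreal (\<integral>\<omega>. \<psi> \<omega> \<partial>M)"
  using integrable_\<psi> \<psi>_nonneg by (intro nn_integral_eq_integral) auto

lemma square_integrable_noise: "square_integrable M (\<lambda>\<omega>. H \<omega> (Z \<omega>))"
proof -
  have "integrable M (\<lambda>\<omega>. (norm (H \<omega> (Z \<omega>)))\<^sup>2)"
  proof (rule integrableI_bounded)
    show "(\<integral>\<^sup>+\<omega>. ennreal (norm ((norm (H \<omega> (Z \<omega>)))\<^sup>2)) \<partial>M) < \<infinity>"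
      using nn_integral_noise nn_integral_\<psi>
      by (simp add: le_less_trans[OF _ ennreal_less_top])
  qed (use measurable_noise in simp)
  then show ?thesis
    using measurable_noise by (simp add: square_integrable_def)
qed

lemma variance_noise: "(\<integral>\<omega>. (norm (H \<omega> (Z \<omega>)))\<^sup>2 \<partial>M) \<le> (\<integral>\<omega>. \<psi> \<omega> \<partial>M)"
proof -
  have "ennreal (\<integral>\<omega>. (norm (H \<omega> (Z \<omega>)))\<^sup>2 \<partial>M) = (\<integral>\<^sup>+\<omega>. ennreal ((norm (H \<omega> (Z \<omega>)))\<^sup>2) \<partial>M)"
    using square_integrable_noise
    by (intro nn_integral_eq_integral[symmetric]) (auto simp: square_integrable_def)
  also have "\<dots> \<le> ennreal (\<integral>\<omega>. \<psi> \<omega> \<partial>M)"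
    using nn_integral_noise nn_integral_\<psi> by simp
  finally show ?thesis
    using \<psi>_nonneg by (subst (asm) ennreal_le_iff) (auto intro!: integral_nonneg_AE)
qed

text \<open>In the inner integral over the seed \<open>u\<close> is a constant, so
  \<open>centered\<close> annihilates the product.\<close>

lemma noise_orthogonal:
  assumes uN: "u \<in> borel_measurable N" and u: "square_integrable M u"
  shows "(\<integral>\<omega>. u \<omega> \<bullet> H \<omega> (Z \<omega>) \<partial>M) = 0"
proof -
  interpret D: prob_space D by (rule prob_spaces)
  interpret S: prob_space S by (rule prob_spaces)
  interpret pair_sigma_finite D S ..
  note measurable_H [measurable] uN [measurable]
  let ?h = "\<lambda>p. u (fst p) \<bullet> (case p of (\<omega>, z) \<Rightarrow> H \<omega> z)"
  have h [measurable]: "?h \<in> borel_measurable (N \<Otimes>\<^sub>M S)"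
    by measurable
  have "integrable M (\<lambda>\<omega>. ?h (\<omega>, Z \<omega>))"
    using integrable_inner_of_square_integrable[OF u square_integrable_noise] by simp
  then have int: "integrable (D \<Otimes>\<^sub>M S) ?h"
    unfolding joint[symmetric] by (subst integrable_distr_eq[OF measurable_pair h]) simp
  have "(\<integral>\<omega>. u \<omega> \<bullet> H \<omega> (Z \<omega>) \<partial>M) = (\<integral>p. ?h p \<partial>(D \<Otimes>\<^sub>M S))"
    unfolding joint[symmetric] by (subst integral_distr[OF measurable_pair h]) simp
  also have "\<dots> = (\<integral>\<omega>. (\<integral>z. ?h (\<omega>, z) \<partial>S) \<partial>D)"
    using integral_fst'[OF int] by simp
  also have "\<dots> = (\<integral>\<omega>. 0 \<partial>D)"
    using centered by (intro Bochner_Integration.integral_cong) (auto simp: space_D)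
  finally show ?thesis by simp
qed

end

text \<open>Unbiasedness turns the cross term of the expanded square into
  \<open>- 2 * (v \<bullet> v)\<close>, which lowers the constant from \<alpha> to
  \<open>\<alpha> - 1\<close>.\<close>

lemma unbiased_compressor_error:
  assumes "unbiased_compressor S Q \<alpha>"
  shows "integrable S (\<lambda>z. Q z v - v)" "(\<integral>z. Q z v - v \<partial>S) = 0"
    "integrable S (\<lambda>z. (norm (Q z v - v))\<^sup>2)"
    "(\<integral>z. (norm (Q z v - v))\<^sup>2 \<partial>S) \<le> (\<alpha> - 1) * (norm v)\<^sup>2"
proof -
  interpret prob_space S
    using assms by (simp add: unbiased_compressor_def)
  have Q: "integrable S (\<lambda>z. Q z v)" "(\<integral>z. Q z v \<partial>S) = v"
    and Q2: "integrable S (\<lambda>z. (norm (Q z v))\<^sup>2)" "(\<integral>z. (norm (Q z v))\<^sup>2 \<partial>S) \<le> \<alpha> * (norm v)\<^sup>2"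
    using assms by (auto simp: unbiased_compressor_def)
  show "integrable S (\<lambda>z. Q z v - v)" "(\<integral>z. Q z v - v \<partial>S) = 0"
    using Q by (simp_all add: prob_space)
  have eq: "(norm (Q z v - v))\<^sup>2 = (norm (Q z v))\<^sup>2 - 2 * (Q z v \<bullet> v) + (norm v)\<^sup>2" for z
    by (simp add: power2_norm_eq_inner inner_diff_left inner_diff_right inner_commute)
  show "integrable S (\<lambda>z. (norm (Q z v - v))\<^sup>2)"
    unfolding eq using Q Q2 by simp
  have "(\<integral>z. (norm (Q z v - v))\<^sup>2 \<partial>S) = (\<integral>z. (norm (Q z v))\<^sup>2 \<partial>S) - 2 * (v \<bullet> v) + (norm v)\<^sup>2"
    unfolding eq using Q Q2 by (simp add: prob_space)
  also have "\<dots> \<le> (\<alpha> - 1) * (norm v)\<^sup>2"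
    using Q2 by (simp add: power2_norm_eq_inner algebra_simps)
  finally show "(\<integral>z. (norm (Q z v - v))\<^sup>2 \<partial>S) \<le> (\<alpha> - 1) * (norm v)\<^sup>2" .
qed

subsection \<open>Convergence\<close>

lemma le_max_or_zero: "finite A \<Longrightarrow> i \<in> A \<Longrightarrow> h i \<le> max_or_zero h A"
  by (auto simp: max_or_zero_def)

lemma max_or_zero_nonneg: "finite A \<Longrightarrow> (\<And>i. i \<in> A \<Longrightarrow> 0 \<le> h i) \<Longrightarrow> 0 \<le> max_or_zero h A"
  by (auto simp: max_or_zero_def Max_ge_iff)

text \<open>The deterministic core of one iteration, with the noise replaced by its variance bound
  \<open>P * V\<close>. Closeness of \<open>m\<close> yields a linear gain of
  \<open>\<gamma> * (1 - b) * (norm g)\<^sup>2\<close>; the step size lets the quadratic term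
  consume at most half of it, up to the \<open>G\<close> term, and \<open>pl\<close> turns the other
  half into contraction.\<close>

lemma inexact_gradient_decrease:
  fixes g m :: "'a::real_inner"
  assumes close: "norm (g - m) \<le> b * norm g" and b: "0 \<le> b" "b < 1"
    and V: "V \<le> K * (G\<^sup>2 + B\<^sup>2 * (norm g)\<^sup>2)"
    and P: "0 \<le> P" and L: "0 < L" and \<gamma>: "0 < \<gamma>"
    and step: "\<gamma> * (L * (K * B\<^sup>2 * P + (1 + b)\<^sup>2)) \<le> 1 - b"
    and pl: "2 * \<mu> * \<Delta> \<le> (norm g)\<^sup>2"
  shows "\<Delta> - \<gamma> * (g \<bullet> m) + L * \<gamma>\<^sup>2 / 2 * ((norm m)\<^sup>2 + P * V)
    \<le> (1 - \<mu> * \<gamma> * (1 - b)) * \<Delta> + L * \<gamma>\<^sup>2 / 2 * (K * G\<^sup>2 * P)"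
proof -
  define n where "n = (norm g)\<^sup>2"
  have "g \<bullet> (g - m) \<le> norm g * norm (g - m)"
    by (rule norm_cauchy_schwarz)
  also have "\<dots> \<le> norm g * (b * norm g)"
    using close by (intro mult_left_mono) auto
  also have "\<dots> = b * n"
    by (simp add: n_def power2_eq_square)
  finally have "(1 - b) * n \<le> g \<bullet> m"
    by (simp add: inner_diff_right n_def power2_norm_eq_inner algebra_simps)
  then have 1: "\<gamma> * ((1 - b) * n) \<le> \<gamma> * (g \<bullet> m)"
    using \<gamma> by (intro mult_left_mono) auto
  have "norm m \<le> norm g + norm (g - m)"
    using norm_triangle_ineq4[of g "g - m"] by simp
  also have "\<dots> \<le> (1 + b) * norm g"
    using close by (simp add: algebra_simps)
  finally have m2: "(norm m)\<^sup>2 \<le> (1 + b)\<^sup>2 * n"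
    unfolding n_def power_mult_distrib[symmetric] by (intro power_mono) auto
  have PV: "P * V \<le> P * (K * (G\<^sup>2 + B\<^sup>2 * n))"
    using V P unfolding n_def by (intro mult_left_mono)
  have 2: "L * \<gamma>\<^sup>2 / 2 * ((norm m)\<^sup>2 + P * V)
      \<le> L * \<gamma>\<^sup>2 / 2 * ((1 + b)\<^sup>2 * n + P * (K * (G\<^sup>2 + B\<^sup>2 * n)))"
    using L by (intro mult_left_mono add_mono m2 PV) auto
  have "\<gamma> * n / 2 * (\<gamma> * (L * (K * B\<^sup>2 * P + (1 + b)\<^sup>2))) \<le> \<gamma> * n / 2 * (1 - b)"
    using step \<gamma> by (intro mult_left_mono) (auto simp: n_def)
  then have 3: "L * \<gamma>\<^sup>2 / 2 * ((1 + b)\<^sup>2 * n + P * (K * (G\<^sup>2 + B\<^sup>2 * n)))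
      \<le> \<gamma> * n / 2 * (1 - b) + L * \<gamma>\<^sup>2 / 2 * (K * G\<^sup>2 * P)"
    by (simp add: algebra_simps power2_eq_square)
  have "\<gamma> * (1 - b) / 2 * (2 * \<mu> * \<Delta>) \<le> \<gamma> * (1 - b) / 2 * n"
    using pl \<gamma> b unfolding n_def by (intro mult_left_mono) auto
  then have 4: "\<mu> * \<gamma> * (1 - b) * \<Delta> \<le> \<gamma> * n / 2 * (1 - b)"
    by (simp add: field_simps)
  have 5: "\<gamma> * ((1 - b) * n) = 2 * (\<gamma> * n / 2 * (1 - b))"
    by simp
  have 6: "(1 - \<mu> * \<gamma> * (1 - b)) * \<Delta> = \<Delta> - \<mu> * \<gamma> * (1 - b) * \<Delta>"
    by (simp add: left_diff_distrib)
  show ?thesis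
    unfolding 6 using 1 2 3 4 5 by linarith
qed

theorem mainTheorem1:
  fixes K :: nat
    and f :: "nat \<Rightarrow> real^'d \<Rightarrow> real" and grad :: "nat \<Rightarrow> real^'d \<Rightarrow> real^'d"
    and F :: "real^'d \<Rightarrow> real" and fstar :: real
    and Lk \<mu>k :: "nat \<Rightarrow> real" and L \<mu> :: real
    and S :: "'z measure" and Q :: "'z \<Rightarrow> real^'d \<Rightarrow> real^'d" and \<alpha> :: real
    and M :: "'w measure" and seed :: "nat \<Rightarrow> nat \<Rightarrow> 'w \<Rightarrow> 'z"
    and slot :: "'s::finite \<Rightarrow> nat" and memory0 :: "nat \<Rightarrow> nat \<Rightarrow> real^'d"
    and ck :: "nat \<Rightarrow> nat \<Rightarrow> real" and \<gamma> :: real and x1 :: "real^'d"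
    and x :: "nat \<Rightarrow> 'w \<Rightarrow> real^'d"
    and g ghat e :: "nat \<Rightarrow> nat \<Rightarrow> 'w \<Rightarrow> real^'d"
    and a :: "nat \<Rightarrow> nat \<Rightarrow> 'w \<Rightarrow> real^'s"
    and gtilde :: "nat \<Rightarrow> int \<Rightarrow> 'w \<Rightarrow> real^'d"
    and eth :: "nat \<Rightarrow> nat \<Rightarrow> 'w \<Rightarrow> real"
    and \<alpha>k :: "nat \<Rightarrow> nat \<Rightarrow> 'w \<Rightarrow> real"
    and G B :: real and bt :: "nat \<Rightarrow> 'w \<Rightarrow> real"
    and t :: nat and b c \<alpha>bar P :: real
  \<comment> \<open>the objective\<close>
  assumes K: "K \<ge> 1"
    and grad: "\<And>k y. k \<in> {1..K} \<Longrightarrow> GDERIV (f k) y :> grad k y"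
    and F: "F = (\<lambda>y. \<Sum>k\<in>{1..K}. f k y)"
    and fstar: "fstar = F (ARG_MIN F y. True)"
  \<comment> \<open>the compressor, applied with fresh independent seeds by every agent in every iteration\<close>
    and \<alpha>: "\<alpha> \<ge> 1"
    and compressor: "unbiased_compressor S Q \<alpha>"
    and M: "prob_space M"
    and seeds_indep: "prob_space.indep_vars M (\<lambda>_. S) (\<lambda>(k, \<tau>). seed k \<tau>) ({1..K} \<times> {1..})"
    and seeds_law: "\<And>k \<tau>. k \<in> {1..K} \<Longrightarrow> \<tau> \<ge> 1 \<Longrightarrow> distr M S (seed k \<tau>) = S"
  \<comment> \<open>the algorithm, with memory length \<open>CARD('s)\<close>\<close>
    and slot: "bij_betw slot UNIV {1..CARD('s)}"
    and ck: "\<And>k \<tau>. k \<in> {1..K} \<Longrightarrow> \<tau> \<ge> 1 \<Longrightarrow> ck k \<tau> \<ge> 0"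
    and x_init: "\<And>\<omega>. \<omega> \<in> space M \<Longrightarrow> x 1 \<omega> = x1"
    and memory_init: "\<And>k j \<omega>. k \<in> {1..K} \<Longrightarrow> j \<in> {1..CARD('s)} \<Longrightarrow> \<omega> \<in> space M \<Longrightarrow>
          gtilde k (1 - int j) \<omega> = memory0 k j"
    and g: "\<And>k \<tau> \<omega>. k \<in> {1..K} \<Longrightarrow> \<tau> \<ge> 1 \<Longrightarrow> \<omega> \<in> space M \<Longrightarrow>
          g k \<tau> \<omega> = grad k (x \<tau> \<omega>)"
    and a: "\<And>k \<tau> \<omega>. k \<in> {1..K} \<Longrightarrow> \<tau> \<ge> 1 \<Longrightarrow> \<omega> \<in> space M \<Longrightarrow>
          a k \<tau> \<omega> = pseudo_inverse (memory_matrix slot (\<lambda>i. gtilde k i \<omega>) \<tau>) *v g k \<tau> \<omega>"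
    and ghat: "\<And>k \<tau> \<omega>. k \<in> {1..K} \<Longrightarrow> \<tau> \<ge> 1 \<Longrightarrow> \<omega> \<in> space M \<Longrightarrow>
          ghat k \<tau> \<omega> = memory_matrix slot (\<lambda>i. gtilde k i \<omega>) \<tau> *v a k \<tau> \<omega>"
    and e: "\<And>k \<tau> \<omega>. k \<in> {1..K} \<Longrightarrow> \<tau> \<ge> 1 \<Longrightarrow> \<omega> \<in> space M \<Longrightarrow>
          e k \<tau> \<omega> = g k \<tau> \<omega> - ghat k \<tau> \<omega>"
    and eth: "\<And>k \<tau> \<omega>. k \<in> {1..K} \<Longrightarrow> \<tau> \<ge> 1 \<Longrightarrow> \<omega> \<in> space M \<Longrightarrow>
          eth k \<tau> \<omega> = ck k \<tau> * norm (g k \<tau> \<omega>)"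
    and gtilde: "\<And>k \<tau> \<omega>. k \<in> {1..K} \<Longrightarrow> \<tau> \<ge> 1 \<Longrightarrow> \<omega> \<in> space M \<Longrightarrow>
          gtilde k (int \<tau>) \<omega> =
            (if norm (e k \<tau> \<omega>) \<le> eth k \<tau> \<omega> then ghat k \<tau> \<omega>
             else ghat k \<tau> \<omega> + Q (seed k \<tau> \<omega>) (e k \<tau> \<omega>))"
    and x_step: "\<And>\<tau> \<omega>. \<tau> \<ge> 1 \<Longrightarrow> \<omega> \<in> space M \<Longrightarrow>
          x (Suc \<tau>) \<omega> = x \<tau> \<omega> - \<gamma> *\<^sub>R (\<Sum>k\<in>{1..K}. gtilde k (int \<tau>) \<omega>)"
    and \<alpha>k: "\<And>k \<tau> \<omega>. k \<in> {1..K} \<Longrightarrow> \<tau> \<ge> 1 \<Longrightarrow> \<omega> \<in> space M \<Longrightarrow>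
          \<alpha>k k \<tau> \<omega> =
            (if g k \<tau> \<omega> = 0 then 1
             else 1 + (\<alpha> - 1) * ((norm (e k \<tau> \<omega>))\<^sup>2 / (norm (g k \<tau> \<omega>))\<^sup>2))"
  \<comment> \<open>(i) Lipschitz gradients\<close>
    and Lk: "\<And>k. k \<in> {1..K} \<Longrightarrow> Lk k > 0"
    and lipschitz: "\<And>k y z. k \<in> {1..K} \<Longrightarrow> norm (grad k y - grad k z) \<le> Lk k * norm (z - y)"
  \<comment> \<open>(ii) strong convexity\<close>
    and \<mu>k: "\<And>k. k \<in> {1..K} \<Longrightarrow> \<mu>k k > 0"
    and strongly_convex: "\<And>k y z. k \<in> {1..K} \<Longrightarrow>
          f k z \<ge> f k y + grad k y \<bullet> (z - y) + \<mu>k k / 2 * (norm (z - y))\<^sup>2"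
  \<comment> \<open>(iii) bounded gradient dissimilarity\<close>
    and G: "G \<ge> 0" and B: "B \<ge> 1"
    and dissimilarity: "\<And>\<tau> \<omega>. \<tau> \<ge> 1 \<Longrightarrow> \<omega> \<in> space M \<Longrightarrow>
          1 / real K * (\<Sum>k\<in>{1..K}. (norm (g k \<tau> \<omega>))\<^sup>2)
            \<le> G\<^sup>2 + B\<^sup>2 * (norm (\<Sum>k\<in>{1..K}. g k \<tau> \<omega>))\<^sup>2"
  \<comment> \<open>(iv) bounded threshold\<close>
    and bt: "\<And>\<tau> \<omega>. \<tau> \<ge> 1 \<Longrightarrow> \<omega> \<in> space M \<Longrightarrow> 0 \<le> bt \<tau> \<omega> \<and> bt \<tau> \<omega> < 1"
    and threshold: "\<And>\<tau> \<omega>. \<tau> \<ge> 1 \<Longrightarrow> \<omega> \<in> space M \<Longrightarrow>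
          (\<Sum>k\<in>{1..K}. eth k \<tau> \<omega>) = bt \<tau> \<omega> * norm (\<Sum>k\<in>{1..K}. g k \<tau> \<omega>)"
  \<comment> \<open>constants and step size\<close>
    and L: "L = (\<Sum>k\<in>{1..K}. Lk k)"
    and \<mu>: "\<mu> = (\<Sum>k\<in>{1..K}. \<mu>k k)"
    and t: "t \<ge> 1"
    and c: "c = max_or_zero (\<lambda>\<tau>. Max ((\<lambda>k. ck k \<tau>) ` {1..K})) {1..t - 1}"
    and b: "\<And>\<omega>. \<omega> \<in> space M \<Longrightarrow> b \<ge> max_or_zero (\<lambda>\<tau>. bt \<tau> \<omega>) {1..t - 1}"
    and \<alpha>bar: "\<And>\<omega>. \<omega> \<in> space M \<Longrightarrow>
          \<alpha>bar \<ge> max_or_zero (\<lambda>\<tau>. Max ((\<lambda>k. \<alpha>k k \<tau> \<omega>) ` {1..K})) {1..t - 1}"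
    and P: "P = max (\<alpha>bar - 1) (c\<^sup>2)"
    and \<gamma>_pos: "0 < \<gamma>"
    and \<gamma>_le: "\<gamma> \<le> (1 - b) / (L * (real K * B\<^sup>2 * P + (1 + b)\<^sup>2))"
  shows "integrable M (\<lambda>\<omega>. F (x t \<omega>) - fstar) \<and>
    (\<integral>\<omega>. (F (x t \<omega>) - fstar) \<partial>M)
      \<le> \<gamma> * L * real K * G\<^sup>2 * P / (2 * \<mu> * (1 - b))
        + (1 - \<mu> * \<gamma> * (1 - b)) ^ (t - 1)
          * (F x1 - fstar - \<gamma> * L * real K * G\<^sup>2 * P / (2 * \<mu> * (1 - b)))"
proof -
  interpret prob_space M by (rule M)
  let ?I = "{1..K}"

  \<comment> \<open>The aggregate objective: smoothness, strong convexity, minimum\<close>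
  define gradF where "gradF y = (\<Sum>k\<in>?I. grad k y)" for y
  have ne: "?I \<noteq> {}" using K by simp
  have L_pos: "0 < L"
    unfolding L using Lk ne by (intro sum_pos) auto
  have \<mu>_pos: "0 < \<mu>"
    unfolding \<mu> using \<mu>k ne by (intro sum_pos) auto
  have \<mu>_le_L: "\<mu> \<le> L"
    unfolding L \<mu>
    by (intro sum_mono strongly_convex_le_lipschitz[OF strongly_convex lipschitz])
  have smooth: "F z \<le> F y + gradF y \<bullet> (z - y) + L / 2 * (norm (z - y))\<^sup>2" for y z
  proof -
    have "F z \<le> (\<Sum>k\<in>?I. f k y + grad k y \<bullet> (z - y) + Lk k / 2 * (norm (z - y))\<^sup>2)"
      unfolding F by (intro sum_mono lipschitz_gradient_upper_bound grad lipschitz)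
    then show ?thesis
      by (simp add: F gradF_def L sum.distrib inner_sum_left sum_distrib_right sum_divide_distrib)
  qed
  have convex: "F z \<ge> F y + gradF y \<bullet> (z - y) + \<mu> / 2 * (norm (z - y))\<^sup>2" for y z
  proof -
    have "(\<Sum>k\<in>?I. f k y + grad k y \<bullet> (z - y) + \<mu>k k / 2 * (norm (z - y))\<^sup>2) \<le> F z"
      unfolding F by (intro sum_mono strongly_convex)
    then show ?thesis
      by (simp add: F gradF_def \<mu> sum.distrib inner_sum_left sum_distrib_right sum_divide_distrib)
  qed
  have cont_f: "continuous_on UNIV (f k)" if "k \<in> ?I" for k
    using grad[OF that] unfolding gderiv_def
    by (auto simp: continuous_on_eq_continuous_at intro: has_derivative_continuous)
  have cont_F: "continuous_on UNIV F"
    unfolding F by (intro continuous_on_sum cont_f)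
  obtain y0 where y0: "\<And>z. F y0 \<le> F z"
    using strongly_convex_has_minimizer[OF cont_F \<mu>_pos, of "gradF 0"] convex[of 0] by auto
  \<comment> \<open>\<open>ARG_MIN\<close> picks a minimizer by choice; once one exists, the value
    does not depend on the choice.\<close>
  have fstar_eq: "fstar = F y0"
    unfolding fstar by (rule arg_min_equality) (use y0 in auto)
  have fstar_le: "fstar \<le> F y" for y
    using y0 fstar_eq by simp
  have pl: "2 * \<mu> * (F y - fstar) \<le> (norm (gradF y))\<^sup>2" for y
    unfolding fstar_eq by (rule polyak_lojasiewicz[OF \<mu>_pos convex])
  have cont_grad: "continuous_on UNIV (grad k)" if "k \<in> ?I" for k
  proof (rule lipschitz_on_continuous_on)
    show "(Lk k)-lipschitz_on UNIV (grad k)"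
      using lipschitz[OF that] Lk[OF that]
      by (auto simp: lipschitz_on_def dist_norm norm_minus_commute)
  qed

  \<comment> \<open>Consequences of the step-size condition\<close>
  have bt_le: "bt \<tau> \<omega> \<le> b" if "1 \<le> \<tau>" "\<tau> < t" "\<omega> \<in> space M" for \<tau> \<omega>
    by (rule order_trans[OF le_max_or_zero[of "{1..t - 1}"] b]) (use that in auto)
  \<comment> \<open>\<open>b\<close> is bounded below outcome by outcome, so its sign needs one
    outcome; for \<open>t = 1\<close> the empty maximum \<open>0\<close> serves.\<close>
  obtain \<omega>0 where \<omega>0: "\<omega>0 \<in> space M"
    using not_empty by blast
  have b0: "0 \<le> b"
    using max_or_zero_nonneg[of "{1..t - 1}" "\<lambda>\<tau>. bt \<tau> \<omega>0"] b[OF \<omega>0] bt \<omega>0 by force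
  \<comment> \<open>The sign comes from \<open>c\<^sup>2\<close>; \<open>\<alpha>bar - 1\<close> may
    be negative when \<open>t = 1\<close>.\<close>
  have P0: "0 \<le> P"
    using P by (simp add: le_max_iff_disj)
  define W where "W = L * (real K * B\<^sup>2 * P + (1 + b)\<^sup>2)"
  have "0 \<le> real K * B\<^sup>2 * P" "1 \<le> (1 + b)\<^sup>2"
    using P0 b0 by (auto simp: one_le_power)
  then have W: "L \<le> W" "0 < W"
    using L_pos by (auto simp: W_def)
  have step: "\<gamma> * W \<le> 1 - b"
    using \<gamma>_le W unfolding W_def[symmetric] by (simp add: pos_le_divide_eq)
  \<comment> \<open>A positive admissible step size already forces this.\<close>
  have b1: "b < 1"
    using step mult_pos_pos[OF \<gamma>_pos W(2)] by simp
  \<comment> \<open>The chain \<open>\<mu> \<le> L \<le> W\<close> bounds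
    \<open>\<mu> * \<gamma>\<close> by \<open>1\<close>. The sign of this factor is what lets the
    recursion be iterated.\<close>
  have \<rho>0: "0 \<le> 1 - \<mu> * \<gamma> * (1 - b)"
  proof -
    have "\<mu> * \<gamma> \<le> \<gamma> * W"
      using \<mu>_le_L W \<gamma>_pos by (simp add: mult.commute)
    then have "\<mu> * \<gamma> \<le> 1"
      using step b0 by simp
    then have "\<mu> * \<gamma> * (1 - b) \<le> 1 * 1"
      using b0 b1 by (intro mult_mono) auto
    then show ?thesis by simp
  qed
  have \<alpha>k_le: "\<alpha>k k \<tau> \<omega> - 1 \<le> P"
    if "k \<in> ?I" "1 \<le> \<tau>" "\<tau> < t" "\<omega> \<in> space M" for k \<tau> \<omega>
  proof -
    have "\<alpha>k k \<tau> \<omega> \<le> Max ((\<lambda>k. \<alpha>k k \<tau> \<omega>) ` ?I)"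
      using that by simp
    also have "\<dots> \<le> max_or_zero (\<lambda>\<tau>. Max ((\<lambda>k. \<alpha>k k \<tau> \<omega>) ` ?I)) {1..t - 1}"
      using that by (intro le_max_or_zero[of "{1..t - 1}"]) auto
    also have "\<dots> \<le> \<alpha>bar"
      using that by (intro \<alpha>bar)
    finally show ?thesis by (simp add: P)
  qed

  \<comment> \<open>Splitting each reconstruction into a predictable part and noise\<close>
  define mem where "mem k \<tau> \<omega> = memory_matrix slot (\<lambda>i. gtilde k i \<omega>) \<tau>" for k \<tau> \<omega>
  have e_eq: "e k \<tau> \<omega> = ls_residual (mem k \<tau> \<omega>) (g k \<tau> \<omega>)"
    if "k \<in> ?I" "1 \<le> \<tau>" "\<omega> \<in> space M" for k \<tau> \<omega>
    using e[OF that] ghat[OF that] a[OF that] by (simp add: ls_residual_def mem_def)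
  have norm_e_le: "norm (e k \<tau> \<omega>) \<le> norm (g k \<tau> \<omega>)"
    if "k \<in> ?I" "1 \<le> \<tau>" "\<omega> \<in> space M" for k \<tau> \<omega>
    using e_eq[OF that] norm_ls_residual_le by metis
  \<comment> \<open>The mean of the reconstruction over the current seed: a silent agent delivers
    its prediction \<open>g - e\<close>, a transmitting one delivers \<open>g\<close> on
    average.\<close>
  define m where "m k \<tau> \<omega> = (if norm (e k \<tau> \<omega>) \<le> ck k \<tau> * norm (g k \<tau> \<omega>)
      then g k \<tau> \<omega> - e k \<tau> \<omega> else g k \<tau> \<omega>)" for k \<tau> \<omega>
  \<comment> \<open>The seed \<open>z\<close> is a separate argument so that it can be averaged with
    \<omega> frozen.\<close>
  define H where "H k \<tau> \<omega> z = (if norm (e k \<tau> \<omega>) \<le> ck k \<tau> * norm (g k \<tau> \<omega>)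
      then 0 else Q z (e k \<tau> \<omega>) - e k \<tau> \<omega>)" for k \<tau> \<omega> z
  define \<xi> where "\<xi> k \<tau> \<omega> = H k \<tau> \<omega> (seed k \<tau> \<omega>)" for k \<tau> \<omega>
  have gtilde_eq: "gtilde k (int \<tau>) \<omega> = m k \<tau> \<omega> + \<xi> k \<tau> \<omega>"
    if "k \<in> ?I" "1 \<le> \<tau>" "\<omega> \<in> space M" for k \<tau> \<omega>
    using e[OF that] by (simp add: gtilde[OF that] eth[OF that] m_def \<xi>_def H_def)

  have x_Suc: "x (Suc \<tau>) \<omega> = x \<tau> \<omega> - \<gamma> *\<^sub>R (\<Sum>k\<in>?I. m k \<tau> \<omega> + \<xi> k \<tau> \<omega>)"
    if "1 \<le> \<tau>" "\<omega> \<in> space M" for \<tau> \<omega>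
    using x_step[OF that] sum.cong[OF refl gtilde_eq[OF _ that], of ?I] by simp

  \<comment> \<open>Dependence of the iterates on past seeds\<close>
  have Q_meas [measurable]: "(\<lambda>p. Q (fst p) (snd p)) \<in> borel_measurable (S \<Otimes>\<^sub>M borel)"
    using compressor by (simp add: unbiased_compressor_def case_prod_beta')
  have slot_range: "1 \<le> slot j \<and> slot j \<le> CARD('s)" for j
    using slot bij_betwE by fastforce

  \<comment> \<open>\<open>N\<close> is left arbitrary because two choices are needed:
    \<open>M\<close> itself, and the algebra of all seeds but one.\<close>
  have step_measurable: "g k \<tau> \<in> borel_measurable N \<and> e k \<tau> \<in> borel_measurable N
      \<and> m k \<tau> \<in> borel_measurable N"
    if N: "space N = space M" and k: "k \<in> ?I" and \<tau>: "1 \<le> \<tau>" and xN: "x \<tau> \<in> borel_measurable N"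
      and past: "\<And>i. 1 - int CARD('s) \<le> i \<Longrightarrow> i < int \<tau> \<Longrightarrow> gtilde k i \<in> borel_measurable N"
    for N :: "'w measure" and k \<tau>
  proof -
    have "(\<lambda>\<omega>. grad k (x \<tau> \<omega>)) \<in> borel_measurable N"
      using measurable_compose[OF xN borel_measurable_continuous_onI[OF cont_grad[OF k]]] .
    then have gN [measurable]: "g k \<tau> \<in> borel_measurable N"
      using g[OF k \<tau>] N by (subst measurable_cong) auto
    have "mem k \<tau> \<in> borel_measurable N"
    proof (rule borel_measurable_matrixI)
      fix i j
      \<comment> \<open>Since \<open>slot j\<close> lies between \<open>1\<close> and
        \<open>CARD('s)\<close>, the column times end at \<open>\<tau> - 1\<close> and never precede
        the oldest initial memory.\<close>
      have "gtilde k (int \<tau> - int (slot j)) \<in> borel_measurable N"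
        using slot_range[of j] \<tau> by (intro past) auto
      then show "(\<lambda>\<omega>. mem k \<tau> \<omega> $ i $ j) \<in> borel_measurable N"
        unfolding mem_def memory_matrix_def
        by (simp add: measurable_compose[OF _ borel_measurable_nth])
    qed
    then have "(\<lambda>\<omega>. ls_residual (mem k \<tau> \<omega>) (g k \<tau> \<omega>)) \<in> borel_measurable N"
      by (rule borel_measurable_ls_residual[OF _ gN])
    then have eN [measurable]: "e k \<tau> \<in> borel_measurable N"
      using e_eq[OF k \<tau>] N by (subst measurable_cong) auto
    have "m k \<tau> \<in> borel_measurable N"
      unfolding m_def by measurable
    then show ?thesis
      using gN eN by blast
  qed
  have \<xi>_measurable: "\<xi> k \<tau> \<in> borel_measurable N"
    if [measurable]: "g k \<tau> \<in> borel_measurable N" "e k \<tau> \<in> borel_measurable N"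
      "seed k \<tau> \<in> N \<rightarrow>\<^sub>M S" for N :: "'w measure" and k \<tau>
  proof -
    have "(\<lambda>\<omega>. Q (seed k \<tau> \<omega>) (e k \<tau> \<omega>)) \<in> borel_measurable N"
      using measurable_compose[OF _ Q_meas, of "\<lambda>\<omega>. (seed k \<tau> \<omega>, e k \<tau> \<omega>)" N] by simp
    then show ?thesis
      unfolding \<xi>_def H_def by measurable
  qed
  have H_measurable: "(\<lambda>(\<omega>, z). H k \<tau> \<omega> z) \<in> borel_measurable (N \<Otimes>\<^sub>M S)"
    if [measurable]: "g k \<tau> \<in> borel_measurable N" "e k \<tau> \<in> borel_measurable N"
    for N :: "'w measure" and k \<tau>
  proof -
    have "(\<lambda>p. Q (snd p) (e k \<tau> (fst p))) \<in> borel_measurable (N \<Otimes>\<^sub>M S)"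
      using measurable_compose[OF _ Q_meas, of "\<lambda>p. (snd p, e k \<tau> (fst p))" "N \<Otimes>\<^sub>M S"] by simp
    then show ?thesis
      unfolding H_def case_prod_beta' by measurable
  qed

  \<comment> \<open>The strict bound \<open>\<sigma> < \<tau>\<close> matters: the state entering
    iteration \<tau> has not seen the seeds of \<tau>, so it stays measurable when one of them is
    left out.\<close>
  have adapted: "x \<tau> \<in> borel_measurable N \<and>
      (\<forall>k\<in>?I. \<forall>i. 1 - int CARD('s) \<le> i \<longrightarrow> i < int \<tau> \<longrightarrow> gtilde k i \<in> borel_measurable N)"
    if \<tau>: "1 \<le> \<tau>" and N: "space N = space M"
      and seeds: "\<And>k \<sigma>. k \<in> ?I \<Longrightarrow> 1 \<le> \<sigma> \<Longrightarrow> \<sigma> < \<tau> \<Longrightarrow> seed k \<sigma> \<in> N \<rightarrow>\<^sub>M S"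
    for N :: "'w measure" and \<tau>
    using \<tau> seeds
  proof (induction \<tau> rule: dec_induct)
    case base
    have "x 1 \<in> borel_measurable N"
      using x_init N by (subst measurable_cong[of _ _ "\<lambda>_. x1"]) auto
    moreover have "gtilde k i \<in> borel_measurable N"
      if "k \<in> ?I" "1 - int CARD('s) \<le> i" "i < int 1" for k i
    proof -
      \<comment> \<open>Times up to \<open>0\<close> hold the initial memory, and time
        \<open>i\<close> has memory index \<open>1 - i\<close>.\<close>
      have "gtilde k i \<omega> = memory0 k (nat (1 - i))" if "\<omega> \<in> space N" for \<omega>
        using memory_init[of k "nat (1 - i)" \<omega>] that N \<open>k \<in> ?I\<close> \<open>1 - int CARD('s) \<le> i\<close> \<open>i < int 1\<close>
        by (simp add: le_nat_iff nat_le_iff)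
      then show ?thesis
        by (subst measurable_cong[of _ _ "\<lambda>_. memory0 k (nat (1 - i))"]) auto
    qed
    ultimately show ?case by blast
  next
    case (step \<tau>)
    have IH: "x \<tau> \<in> borel_measurable N"
      "\<And>k i. k \<in> ?I \<Longrightarrow> 1 - int CARD('s) \<le> i \<Longrightarrow> i < int \<tau> \<Longrightarrow> gtilde k i \<in> borel_measurable N"
      using step.IH step.prems by auto
    have now: "gtilde k (int \<tau>) \<in> borel_measurable N" if k: "k \<in> ?I" for k
    proof -
      have "g k \<tau> \<in> borel_measurable N" "e k \<tau> \<in> borel_measurable N" "m k \<tau> \<in> borel_measurable N"
        using step_measurable[OF N k step.hyps(1) IH(1) IH(2)[OF k]] by auto
      moreover from this have "\<xi> k \<tau> \<in> borel_measurable N"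
        using step.prems[OF k step.hyps(1)] by (intro \<xi>_measurable) auto
      ultimately have "(\<lambda>\<omega>. m k \<tau> \<omega> + \<xi> k \<tau> \<omega>) \<in> borel_measurable N"
        by simp
      then show ?thesis
        using gtilde_eq[OF k step.hyps(1)] N by (subst measurable_cong) auto
    qed
    have "(\<lambda>\<omega>. x \<tau> \<omega> - \<gamma> *\<^sub>R (\<Sum>k\<in>?I. gtilde k (int \<tau>) \<omega>)) \<in> borel_measurable N"
      using IH(1) now by (intro borel_measurable_diff borel_measurable_scaleR borel_measurable_sum) auto
    then have "x (Suc \<tau>) \<in> borel_measurable N"
      using x_step[OF step.hyps(1)] N by (subst measurable_cong) auto
    moreover have "gtilde k i \<in> borel_measurable N"
      if "k \<in> ?I" "1 - int CARD('s) \<le> i" "i < int (Suc \<tau>)" for k i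
      using IH(2)[of k i] now[of k] that by (cases "i = int \<tau>") auto
    ultimately show ?case by blast
  qed
  have adapted_step: "g k \<tau> \<in> borel_measurable N \<and> e k \<tau> \<in> borel_measurable N
      \<and> m k \<tau> \<in> borel_measurable N"
    if "k \<in> ?I" "1 \<le> \<tau>" "space N = space M"
      "\<And>k \<sigma>. k \<in> ?I \<Longrightarrow> 1 \<le> \<sigma> \<Longrightarrow> \<sigma> < \<tau> \<Longrightarrow> seed k \<sigma> \<in> N \<rightarrow>\<^sub>M S"
    for N :: "'w measure" and k \<tau>
    using adapted[OF that(2-4)] that(1-3) by (intro step_measurable) auto
  have seed_M: "seed k \<tau> \<in> M \<rightarrow>\<^sub>M S" if "k \<in> ?I" "1 \<le> \<tau>" for k \<tau>
    using seeds_indep that unfolding indep_vars_def by auto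
  have measurable_M: "g k \<tau> \<in> borel_measurable M" "e k \<tau> \<in> borel_measurable M"
      "m k \<tau> \<in> borel_measurable M" "x \<tau> \<in> borel_measurable M"
    if "k \<in> ?I" "1 \<le> \<tau>" for k \<tau>
    using adapted_step[OF that, of M] adapted[OF that(2), of M] seed_M by auto

  \<comment> \<open>The noise of one agent in one iteration\<close>
  have fresh: "\<exists>N. fresh_kernel M N S (seed k \<tau>) (H k \<tau>) (\<lambda>\<omega>. P * (norm (g k \<tau> \<omega>))\<^sup>2) \<and>
      (\<forall>l\<in>?I. \<forall>\<sigma>\<ge>1. (l, \<sigma>) \<noteq> (k, \<tau>) \<longrightarrow> seed l \<sigma> \<in> N \<rightarrow>\<^sub>M S)"
    if k: "k \<in> ?I" and \<tau>: "1 \<le> \<tau>" "\<tau> < t" and sq: "square_integrable M (g k \<tau>)" for k \<tau>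
  proof -
    have "(k, \<tau>) \<in> ?I \<times> {1..}" using k \<tau> by simp
    from other_variables_algebra[OF seeds_indep this] obtain N where N: "space N = space M"
      and sets_N: "sets N \<subseteq> sets M"
      and other: "\<And>i. i \<in> ?I \<times> {1..} \<Longrightarrow> i \<noteq> (k, \<tau>) \<Longrightarrow> (case i of (k, \<tau>) \<Rightarrow> seed k \<tau>) \<in> N \<rightarrow>\<^sub>M S"
      and ind: "\<And>A B. A \<in> sets N \<Longrightarrow> B \<in> sets S \<Longrightarrow>
        prob (A \<inter> ((case (k, \<tau>) of (k, \<tau>) \<Rightarrow> seed k \<tau>) -` B \<inter> space M))
        = prob A * prob ((case (k, \<tau>) of (k, \<tau>) \<Rightarrow> seed k \<tau>) -` B \<inter> space M)"
      by metis
    have others: "seed l \<sigma> \<in> N \<rightarrow>\<^sub>M S" if "l \<in> ?I" "1 \<le> \<sigma>" "(l, \<sigma>) \<noteq> (k, \<tau>)" for l \<sigma>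
      using other[of "(l, \<sigma>)"] that by simp
    have gN: "g k \<tau> \<in> borel_measurable N" and eN: "e k \<tau> \<in> borel_measurable N"
      using adapted_step[OF k \<tau>(1) N] others by auto
    have "fresh_kernel M N S (seed k \<tau>) (H k \<tau>) (\<lambda>\<omega>. P * (norm (g k \<tau> \<omega>))\<^sup>2)"
    proof (unfold_locales)
      show "space N = space M" "sets N \<subseteq> sets M" by fact+
      show "seed k \<tau> \<in> M \<rightarrow>\<^sub>M S" "distr M S (seed k \<tau>) = S"
        using seed_M[OF k \<tau>(1)] seeds_law[OF k \<tau>(1)] .
      show "prob (A \<inter> (seed k \<tau> -` B \<inter> space M)) = prob A * prob (seed k \<tau> -` B \<inter> space M)"
        if "A \<in> sets N" "B \<in> sets S" for A B
        using ind[OF that] by simp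
      show "(\<lambda>(\<omega>, z). H k \<tau> \<omega> z) \<in> borel_measurable (N \<Otimes>\<^sub>M S)"
        by (rule H_measurable[OF gN eN])
      show "(\<lambda>\<omega>. P * (norm (g k \<tau> \<omega>))\<^sup>2) \<in> borel_measurable N"
        using gN by measurable
      show "integrable M (\<lambda>\<omega>. P * (norm (g k \<tau> \<omega>))\<^sup>2)"
        using sq by (simp add: square_integrable_def)
      fix \<omega> assume \<omega>: "\<omega> \<in> space M"
      show "integrable S (H k \<tau> \<omega>) \<and> (\<integral>z. H k \<tau> \<omega> z \<partial>S) = 0"
        unfolding H_def using unbiased_compressor_error[OF compressor, of "e k \<tau> \<omega>"]
        by (cases "norm (e k \<tau> \<omega>) \<le> ck k \<tau> * norm (g k \<tau> \<omega>)") auto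
      have "(\<alpha> - 1) * (norm (e k \<tau> \<omega>))\<^sup>2 \<le> P * (norm (g k \<tau> \<omega>))\<^sup>2"
      proof (cases "g k \<tau> \<omega> = 0")
        case True
        then show ?thesis using norm_e_le[OF k \<tau>(1) \<omega>] by simp
      next
        case False
        then show ?thesis
          using \<alpha>k_le[OF k \<tau> \<omega>] \<alpha>k[OF k \<tau>(1) \<omega>] by (simp add: field_simps)
      qed
      then show "integrable S (\<lambda>z. (norm (H k \<tau> \<omega> z))\<^sup>2) \<and>
          (\<integral>z. (norm (H k \<tau> \<omega> z))\<^sup>2 \<partial>S) \<le> P * (norm (g k \<tau> \<omega>))\<^sup>2"
        unfolding H_def using unbiased_compressor_error[OF compressor, of "e k \<tau> \<omega>"] P0
        by (cases "norm (e k \<tau> \<omega>) \<le> ck k \<tau> * norm (g k \<tau> \<omega>)") auto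
    qed
    then show ?thesis using others by blast
  qed

  \<comment> \<open>Square integrability along the run\<close>
  have sq_g: "square_integrable M (g k \<tau>)"
    if k: "k \<in> ?I" and \<tau>: "1 \<le> \<tau>" and x: "square_integrable M (x \<tau>)" for k \<tau>
  proof -
    have "square_integrable M (\<lambda>\<omega>. g k \<tau> \<omega> - grad k 0)"
      using x
    proof (rule square_integrable_bound)
      show "(\<lambda>\<omega>. g k \<tau> \<omega> - grad k 0) \<in> borel_measurable M"
        using measurable_M(1)[OF k \<tau>] by simp
      show "norm (g k \<tau> \<omega> - grad k 0) \<le> Lk k * norm (x \<tau> \<omega>)" if "\<omega> \<in> space M" for \<omega>
        using lipschitz[OF k, of "x \<tau> \<omega>" 0] g[OF k \<tau> that] by simp
    qed
    from square_integrable_add[OF this square_integrable_const[of "grad k 0"]]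
    show ?thesis by simp
  qed
  have sq_m: "square_integrable M (m k \<tau>)"
    if k: "k \<in> ?I" and \<tau>: "1 \<le> \<tau>" and x: "square_integrable M (x \<tau>)" for k \<tau>
  proof (rule square_integrable_bound[OF sq_g[OF that] measurable_M(3)[OF k \<tau>], of 2])
    show "norm (m k \<tau> \<omega>) \<le> 2 * norm (g k \<tau> \<omega>)" if "\<omega> \<in> space M" for \<omega>
      using norm_e_le[OF k \<tau> that] norm_triangle_ineq4[of "g k \<tau> \<omega>" "e k \<tau> \<omega>"]
      by (auto simp: m_def)
  qed
  have sq_\<xi>: "square_integrable M (\<xi> k \<tau>)"
    if k: "k \<in> ?I" and \<tau>: "1 \<le> \<tau>" "\<tau> < t" and x: "square_integrable M (x \<tau>)" for k \<tau>
    using fresh[OF k \<tau> sq_g[OF k \<tau>(1) x]] fresh_kernel.square_integrable_noise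
    unfolding \<xi>_def by blast
  \<comment> \<open>The finite variance of the noise at \<tau> is derived from that of
    \<open>x \<tau>\<close>, hence the induction over iterations.\<close>
  have sq_x: "square_integrable M (x \<tau>)" if "1 \<le> \<tau>" "\<tau> \<le> t" for \<tau>
    using that
  proof (induction \<tau> rule: dec_induct)
    case base
    show ?case
      using square_integrable_const[of x1] square_integrable_cong[of M "x 1" "\<lambda>_. x1"] x_init by simp
  next
    case (step \<tau>)
    then have x: "square_integrable M (x \<tau>)" and \<tau>: "1 \<le> \<tau>" "\<tau> < t" by auto
    have "square_integrable M (\<lambda>\<omega>. x \<tau> \<omega> - \<gamma> *\<^sub>R (\<Sum>k\<in>?I. m k \<tau> \<omega> + \<xi> k \<tau> \<omega>))"
      by (intro square_integrable_diff square_integrable_scaleR square_integrable_sum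
          square_integrable_add x sq_m sq_\<xi> \<tau>)
    then show ?case
      by (subst square_integrable_cong[OF x_Suc[OF \<tau>(1)]])
  qed

  \<comment> \<open>The expected suboptimality and its recursion\<close>
  have int_F: "integrable M (\<lambda>\<omega>. F (x \<tau> \<omega>) - fstar)" if "1 \<le> \<tau>" "\<tau> \<le> t" for \<tau>
  proof (rule Bochner_Integration.integrable_bound)
    note x = sq_x[OF that]
    \<comment> \<open>The majorant is smoothness at \<open>0\<close>; the gap is nonnegative, so
      this dominates its absolute value.\<close>
    show "integrable M (\<lambda>\<omega>. F 0 - fstar + gradF 0 \<bullet> x \<tau> \<omega> + L / 2 * (norm (x \<tau> \<omega>))\<^sup>2)"
      using x integrable_inner_of_square_integrable[OF square_integrable_const[of "gradF 0"] x]
      by (simp add: square_integrable_def)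
    show "(\<lambda>\<omega>. F (x \<tau> \<omega>) - fstar) \<in> borel_measurable M"
      using measurable_compose[OF _ borel_measurable_continuous_onI[OF cont_F], of "x \<tau>" M] x
      by (simp add: square_integrable_def)
    show "AE \<omega> in M. norm (F (x \<tau> \<omega>) - fstar)
        \<le> norm (F 0 - fstar + gradF 0 \<bullet> x \<tau> \<omega> + L / 2 * (norm (x \<tau> \<omega>))\<^sup>2)"
    proof (rule AE_I2)
      fix \<omega>
      show "norm (F (x \<tau> \<omega>) - fstar)
          \<le> norm (F 0 - fstar + gradF 0 \<bullet> x \<tau> \<omega> + L / 2 * (norm (x \<tau> \<omega>))\<^sup>2)"
        using fstar_le[of "x \<tau> \<omega>"] smooth[of "x \<tau> \<omega>" 0] by simp
    qed
  qed

  define E where "E \<tau> = (\<integral>\<omega>. F (x \<tau> \<omega>) - fstar \<partial>M)" for \<tau>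
  \<comment> \<open>The limiting error level, chosen as fixed point of the one-step bound;
    \<open>drift\<close> confirms it.\<close>
  define C where "C = \<gamma> * L * real K * G\<^sup>2 * P / (2 * \<mu> * (1 - b))"
  have drift: "(1 - (1 - \<mu> * \<gamma> * (1 - b))) * C = L * \<gamma>\<^sup>2 / 2 * (K * G\<^sup>2 * P)"
    using \<mu>_pos b1 unfolding C_def by (simp add: field_simps power2_eq_square)

  have recursion: "E (Suc \<tau>) \<le> (1 - \<mu> * \<gamma> * (1 - b)) * E \<tau> + (1 - (1 - \<mu> * \<gamma> * (1 - b))) * C"
    if \<tau>: "1 \<le> \<tau>" "\<tau> < t" for \<tau>
  proof -
    note x = sq_x[OF \<tau>(1) less_imp_le[OF \<tau>(2)]]
    note sg = sq_g[OF _ \<tau>(1) x] and sm = sq_m[OF _ \<tau>(1) x] and s\<xi> = sq_\<xi>[OF _ \<tau> x]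
    define gg where "gg \<omega> = (\<Sum>k\<in>?I. g k \<tau> \<omega>)" for \<omega>
    define mm where "mm \<omega> = (\<Sum>k\<in>?I. m k \<tau> \<omega>)" for \<omega>
    define \<Xi> where "\<Xi> \<omega> = (\<Sum>k\<in>?I. \<xi> k \<tau> \<omega>)" for \<omega>
    define V where "V \<omega> = (\<Sum>k\<in>?I. (norm (g k \<tau> \<omega>))\<^sup>2)" for \<omega>
    have sgg: "square_integrable M gg" and smm: "square_integrable M mm" and s\<Xi>: "square_integrable M \<Xi>"
      unfolding gg_def mm_def \<Xi>_def by (intro square_integrable_sum sg sm s\<xi>; simp)+
    have gg_eq: "gg \<omega> = gradF (x \<tau> \<omega>)" if "\<omega> \<in> space M" for \<omega>
      using g \<tau> that by (simp add: gg_def gradF_def)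

    \<comment> \<open>Leaving out only the seed \<open>(k, \<tau>)\<close> keeps the simultaneous
      seeds of the other agents, so \<open>\<xi> l \<tau>\<close> with \<open>l \<noteq> k\<close>
      can be tested against \<open>\<xi> k \<tau>\<close> just like \<open>gg\<close> and
      \<open>mm\<close>.\<close>
    have orth: "(\<integral>\<omega>. gg \<omega> \<bullet> \<xi> k \<tau> \<omega> \<partial>M) = 0" "(\<integral>\<omega>. mm \<omega> \<bullet> \<xi> k \<tau> \<omega> \<partial>M) = 0"
        "\<And>l. l \<in> ?I \<Longrightarrow> l \<noteq> k \<Longrightarrow> (\<integral>\<omega>. \<xi> l \<tau> \<omega> \<bullet> \<xi> k \<tau> \<omega> \<partial>M) = 0"
      and var: "(\<integral>\<omega>. (norm (\<xi> k \<tau> \<omega>))\<^sup>2 \<partial>M) \<le> (\<integral>\<omega>. P * (norm (g k \<tau> \<omega>))\<^sup>2 \<partial>M)"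
      if k: "k \<in> ?I" for k
    proof -
      obtain N where N: "fresh_kernel M N S (seed k \<tau>) (H k \<tau>) (\<lambda>\<omega>. P * (norm (g k \<tau> \<omega>))\<^sup>2)"
        and other: "\<forall>l\<in>?I. \<forall>\<sigma>\<ge>1. (l, \<sigma>) \<noteq> (k, \<tau>) \<longrightarrow> seed l \<sigma> \<in> N \<rightarrow>\<^sub>M S"
        using fresh[OF k \<tau> sg[OF k]] by (elim exE conjE)
      have others: "seed l \<sigma> \<in> N \<rightarrow>\<^sub>M S" if "l \<in> ?I" "1 \<le> \<sigma>" "(l, \<sigma>) \<noteq> (k, \<tau>)" for l \<sigma>
        by (rule other[rule_format, OF that])
      have spN: "space N = space M"
        using N by (rule fresh_kernel.space_N)
      have N_meas: "g l \<tau> \<in> borel_measurable N" "e l \<tau> \<in> borel_measurable N"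
          "m l \<tau> \<in> borel_measurable N" if "l \<in> ?I" for l
        using adapted_step[OF that \<tau>(1) spN] others by auto
      note zero = fresh_kernel.noise_orthogonal[OF N, folded \<xi>_def]
      show "(\<integral>\<omega>. gg \<omega> \<bullet> \<xi> k \<tau> \<omega> \<partial>M) = 0"
        using sgg by (intro zero) (auto simp: gg_def[abs_def] intro!: borel_measurable_sum N_meas)
      show "(\<integral>\<omega>. mm \<omega> \<bullet> \<xi> k \<tau> \<omega> \<partial>M) = 0"
        using smm by (intro zero) (auto simp: mm_def[abs_def] intro!: borel_measurable_sum N_meas)
      show "(\<integral>\<omega>. \<xi> l \<tau> \<omega> \<bullet> \<xi> k \<tau> \<omega> \<partial>M) = 0" if "l \<in> ?I" "l \<noteq> k" for l
        using that \<tau>(1) by (intro zero s\<xi> \<xi>_measurable N_meas others) auto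
      show "(\<integral>\<omega>. (norm (\<xi> k \<tau> \<omega>))\<^sup>2 \<partial>M) \<le> (\<integral>\<omega>. P * (norm (g k \<tau> \<omega>))\<^sup>2 \<partial>M)"
        unfolding \<xi>_def by (rule fresh_kernel.variance_noise[OF N])
    qed

    note int = integrable_inner_of_square_integrable
    have int_g: "integrable M (\<lambda>\<omega>. (norm (g k \<tau> \<omega>))\<^sup>2)" if "k \<in> ?I" for k
      using sg[OF that] by (simp add: square_integrable_def)
    have int_V: "integrable M V"
      unfolding V_def by (intro Bochner_Integration.integrable_sum int_g)
    have int_sq: "integrable M (\<lambda>\<omega>. (norm (mm \<omega> + \<Xi> \<omega>))\<^sup>2)" "integrable M (\<lambda>\<omega>. (norm (mm \<omega>))\<^sup>2)"
      using square_integrable_add[OF smm s\<Xi>] smm by (auto simp: square_integrable_def)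
    have gg\<Xi>: "(\<integral>\<omega>. gg \<omega> \<bullet> \<Xi> \<omega> \<partial>M) = 0"
      unfolding \<Xi>_def inner_sum_right
      by (subst Bochner_Integration.integral_sum[OF int[OF sgg s\<xi>]]) (auto intro!: sum.neutral orth(1))
    have "(\<integral>\<omega>. (norm (mm \<omega> + \<Xi> \<omega>))\<^sup>2 \<partial>M)
        = (\<integral>\<omega>. (norm (mm \<omega>))\<^sup>2 \<partial>M) + (\<Sum>k\<in>?I. \<integral>\<omega>. (norm (\<xi> k \<tau> \<omega>))\<^sup>2 \<partial>M)"
      unfolding \<Xi>_def
      by (intro integral_norm_square_orthogonal_sum smm s\<xi> orth) auto
    also have "\<dots> \<le> (\<integral>\<omega>. (norm (mm \<omega>))\<^sup>2 \<partial>M) + (\<Sum>k\<in>?I. \<integral>\<omega>. P * (norm (g k \<tau> \<omega>))\<^sup>2 \<partial>M)"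
      by (intro add_left_mono sum_mono var)
    also have "(\<Sum>k\<in>?I. \<integral>\<omega>. P * (norm (g k \<tau> \<omega>))\<^sup>2 \<partial>M) = (\<integral>\<omega>. P * V \<omega> \<partial>M)"
      unfolding V_def sum_distrib_left
      by (intro Bochner_Integration.integral_sum[symmetric] integrable_mult_right int_g)
    finally have second_moment: "(\<integral>\<omega>. (norm (mm \<omega> + \<Xi> \<omega>))\<^sup>2 \<partial>M)
        \<le> (\<integral>\<omega>. (norm (mm \<omega>))\<^sup>2 \<partial>M) + (\<integral>\<omega>. P * V \<omega> \<partial>M)" .

    \<comment> \<open>Smoothness along the actual step. The product
      \<open>gg \<omega> \<bullet> \<Xi> \<omega>\<close> is kept apart because it vanishes in the
      mean, not pointwise.\<close>
    have descent: "F (x (Suc \<tau>) \<omega>) - fstar \<le> F (x \<tau> \<omega>) - fstar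
        - \<gamma> * (gg \<omega> \<bullet> mm \<omega> + gg \<omega> \<bullet> \<Xi> \<omega>) + L * \<gamma>\<^sup>2 / 2 * (norm (mm \<omega> + \<Xi> \<omega>))\<^sup>2"
      if \<omega>: "\<omega> \<in> space M" for \<omega>
    proof -
      have diff: "x (Suc \<tau>) \<omega> - x \<tau> \<omega> = - (\<gamma> *\<^sub>R (mm \<omega> + \<Xi> \<omega>))"
        unfolding x_Suc[OF \<tau>(1) \<omega>] by (simp add: mm_def \<Xi>_def sum.distrib)
      then show ?thesis
        using smooth[of "x (Suc \<tau>) \<omega>" "x \<tau> \<omega>", unfolded diff] \<gamma>_pos
        by (simp add: gg_eq[OF \<omega>] inner_add_right power_mult_distrib mult.assoc)
    qed
    have contraction: "F (x \<tau> \<omega>) - fstar - \<gamma> * (gg \<omega> \<bullet> mm \<omega>)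
          + L * \<gamma>\<^sup>2 / 2 * ((norm (mm \<omega>))\<^sup>2 + P * V \<omega>)
        \<le> (1 - \<mu> * \<gamma> * (1 - b)) * (F (x \<tau> \<omega>) - fstar) + L * \<gamma>\<^sup>2 / 2 * (K * G\<^sup>2 * P)"
      if \<omega>: "\<omega> \<in> space M" for \<omega>
    proof (rule inexact_gradient_decrease[OF _ b0 b1 _ P0 L_pos \<gamma>_pos])
      \<comment> \<open>Only silent agents contribute to the difference, each at most its threshold;
        for the others nonnegativity of \<open>ck\<close> suffices.\<close>
      have "norm (gg \<omega> - mm \<omega>) \<le> (\<Sum>k\<in>?I. norm (g k \<tau> \<omega> - m k \<tau> \<omega>))"
        unfolding gg_def mm_def sum_subtractf[symmetric] by (rule norm_sum)
      also have "\<dots> \<le> (\<Sum>k\<in>?I. eth k \<tau> \<omega>)"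
        using ck \<tau> \<omega> by (intro sum_mono) (auto simp: m_def eth)
      also have "\<dots> = bt \<tau> \<omega> * norm (gg \<omega>)"
        unfolding gg_def using threshold[OF \<tau>(1) \<omega>] .
      also have "\<dots> \<le> b * norm (gg \<omega>)"
        by (intro mult_right_mono bt_le \<tau> \<omega>) auto
      finally show "norm (gg \<omega> - mm \<omega>) \<le> b * norm (gg \<omega>)" .
      show "V \<omega> \<le> real K * (G\<^sup>2 + B\<^sup>2 * (norm (gg \<omega>))\<^sup>2)"
        using dissimilarity[OF \<tau>(1) \<omega>] K unfolding V_def gg_def by (simp add: field_simps)
      show "\<gamma> * (L * (real K * B\<^sup>2 * P + (1 + b)\<^sup>2)) \<le> 1 - b"
        using step by (simp add: W_def)
      show "2 * \<mu> * (F (x \<tau> \<omega>) - fstar) \<le> (norm (gg \<omega>))\<^sup>2"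
        using pl gg_eq[OF \<omega>] by simp
    qed
    note ints = int_F[OF \<tau>(1) less_imp_le[OF \<tau>(2)]] int[OF sgg smm] int[OF sgg s\<Xi>] int_V int_sq

    have "E (Suc \<tau>) \<le> (\<integral>\<omega>. F (x \<tau> \<omega>) - fstar
        - \<gamma> * (gg \<omega> \<bullet> mm \<omega> + gg \<omega> \<bullet> \<Xi> \<omega>) + L * \<gamma>\<^sup>2 / 2 * (norm (mm \<omega> + \<Xi> \<omega>))\<^sup>2 \<partial>M)"
      unfolding E_def using \<tau> ints descent
      by (intro integral_mono int_F Bochner_Integration.integrable_add
          Bochner_Integration.integrable_diff integrable_mult_right) auto
    also have "\<dots> = E \<tau> - \<gamma> * (\<integral>\<omega>. gg \<omega> \<bullet> mm \<omega> \<partial>M)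
        + L * \<gamma>\<^sup>2 / 2 * (\<integral>\<omega>. (norm (mm \<omega> + \<Xi> \<omega>))\<^sup>2 \<partial>M)"
      unfolding E_def using ints gg\<Xi>
      by (subst Bochner_Integration.integral_add Bochner_Integration.integral_diff
          integral_mult_right_zero; simp)+
    also have "\<dots> \<le> E \<tau> - \<gamma> * (\<integral>\<omega>. gg \<omega> \<bullet> mm \<omega> \<partial>M)
        + L * \<gamma>\<^sup>2 / 2 * ((\<integral>\<omega>. (norm (mm \<omega>))\<^sup>2 \<partial>M) + (\<integral>\<omega>. P * V \<omega> \<partial>M))"
      using L_pos by (intro add_left_mono mult_left_mono second_moment) auto
    \<comment> \<open>The integrals are recombined so that the pointwise bound
      \<open>contraction\<close> applies under the integral sign.\<close>
    also have "\<dots> = (\<integral>\<omega>. F (x \<tau> \<omega>) - fstar - \<gamma> * (gg \<omega> \<bullet> mm \<omega>)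
          + L * \<gamma>\<^sup>2 / 2 * ((norm (mm \<omega>))\<^sup>2 + P * V \<omega>) \<partial>M)"
      unfolding E_def using ints
      by (subst Bochner_Integration.integral_add Bochner_Integration.integral_diff
          integral_mult_right_zero; simp)+
    also have "\<dots> \<le> (\<integral>\<omega>. (1 - \<mu> * \<gamma> * (1 - b)) * (F (x \<tau> \<omega>) - fstar)
        + L * \<gamma>\<^sup>2 / 2 * (K * G\<^sup>2 * P) \<partial>M)"
      using contraction
      by (intro integral_mono ints Bochner_Integration.integrable_add
          Bochner_Integration.integrable_diff integrable_mult_right) auto
    also have "\<dots> = (1 - \<mu> * \<gamma> * (1 - b)) * E \<tau> + L * \<gamma>\<^sup>2 / 2 * (K * G\<^sup>2 * P)"
      unfolding E_def using ints by (subst Bochner_Integration.integral_add) (auto simp: prob_space)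
    finally show ?thesis
      unfolding drift .
  qed
  have "E t \<le> C + (1 - \<mu> * \<gamma> * (1 - b)) ^ (t - 1) * (E 1 - C)"
    using recursion \<rho>0 t by (intro affine_recursion_bound[where t = t]) auto
  moreover have "E 1 = F x1 - fstar"
  proof -
    have "E 1 = (\<integral>\<omega>. F x1 - fstar \<partial>M)"
      unfolding E_def using x_init by (intro Bochner_Integration.integral_cong) auto
    then show ?thesis by (simp add: prob_space)
  qed
  ultimately show ?thesis
    using int_F[OF t order_refl] unfolding E_def C_def by simp
qed

end
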